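(* Let $\varphi:A_1\to A_1$ be a homomorphism of $K$-algebras. Assume $\operatorname{Im}\varphi\cap(\Omega_1\cup\Omega_2)\neq\emptyset$, where $\Omega_i=\Omega_i(A_1)$. Then $\varphi\in \mathrm{Aut}(A_1)$.
   Context: $K$ is an algebraically closed field of characteristic zero; algebras and homomorphisms are unital. $A_1$ is the first Weyl algebra over $K$, generated by $p,q$ with $[q,p]=1$. For $z\in A_1$ put $ad_z(w)=[z,w]=zw-wz$ and $Ev(z)=\{\lambda\in K\mid \exists x\in A_1\setminus\{0\},\ ad_z(x)=\lambda x\}$, $F(z)=\{x\in A_1\mid \dim_K K[ad_z](x)<\infty\}$, $N(z)=\{x\in A_1\mid \exists m,\ ad_z^m(x)=0\}$, $C(z)=\{x\in A_1\mid ad_z(x)=0\}$, $D(z)=\bigoplus_{\lambda\in Ev(z)}\{x\in A_1\mid ad_z(x)=\lambda x\}$. $\Omega_1$ (strictly nilpotent elements) is the set of $z\in A_1$ with $Ev(z)=\{0\}$ and $C(z)\subsetneq N(z)=A_1$. $\Omega_2$ (strictly semisimple elements) is the set of $z\in A_1$ with $Ev(z)\supsetneq\{0\}$ and $D(z)=F(z)=A_1$. *)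

theory Defs
  imports "HOL-Library.Poly_Mapping" "HOL-Computational_Algebra.Polynomial"
begin

section \<open>The free algebra on two generators\<close>

datatype weyl_gen = Gen_p | Gen_q

text \<open>
  A copy of the lists over the two generators, made additive under concatenation:
  \<open>weyl_word \<Rightarrow>\<^sub>0 'k\<close>, with the convolution product of the library, is then the free
  associative unital algebra on two generators.
\<close>

datatype weyl_word = Word (letters: "weyl_gen list")

instantiation weyl_word :: monoid_add
begin

definition zero_weyl_word :: weyl_word
  where "0 = Word []"

definition plus_weyl_word :: "weyl_word \<Rightarrow> weyl_word \<Rightarrow> weyl_word"
  where "u + v = Word (letters u @ letters v)"

instance
  by standard (simp_all add: zero_weyl_word_def plus_weyl_word_def)

end

definition free_gen :: "weyl_gen \<Rightarrow> (weyl_word \<Rightarrow>\<^sub>0 'k::field)"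
  where "free_gen g = Poly_Mapping.single (Word [g]) 1"

definition weyl_relator :: "weyl_word \<Rightarrow>\<^sub>0 'k::field"
  where "weyl_relator = free_gen Gen_q * free_gen Gen_p - free_gen Gen_p * free_gen Gen_q - 1"

text \<open>The two-sided ideal generated by the relator \<open>[q, p] - 1\<close>.\<close>

inductive_set weyl_ideal :: "(weyl_word \<Rightarrow>\<^sub>0 'k::field) set"
  where
    zero: "0 \<in> weyl_ideal"
  | step: "x \<in> weyl_ideal \<Longrightarrow> x + a * weyl_relator * b \<in> weyl_ideal"

lemma weyl_ideal_add: "y \<in> weyl_ideal \<Longrightarrow> x \<in> weyl_ideal \<Longrightarrow> x + y \<in> weyl_ideal"
proof (induction y rule: weyl_ideal.induct)
  case (step y a b)
  then show ?case using weyl_ideal.step[of "x + y" a b] by (simp add: add.assoc)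
qed simp

lemma weyl_ideal_mult: "x \<in> weyl_ideal \<Longrightarrow> a * x * b \<in> weyl_ideal"
proof (induction x rule: weyl_ideal.induct)
  case zero
  show ?case by (simp add: weyl_ideal.zero)
next
  case (step x c d)
  have "a * (x + c * weyl_relator * d) * b = a * x * b + (a * c) * weyl_relator * (d * b)"
    by (simp add: algebra_simps)
  then show ?case using weyl_ideal.step[OF step.IH] by simp
qed

lemma weyl_ideal_mult_left: "x \<in> weyl_ideal \<Longrightarrow> a * x \<in> weyl_ideal"
  using weyl_ideal_mult[of x a 1] by simp

lemma weyl_ideal_mult_right: "x \<in> weyl_ideal \<Longrightarrow> x * b \<in> weyl_ideal"
  using weyl_ideal_mult[of x 1 b] by simp

lemma weyl_ideal_uminus: "x \<in> weyl_ideal \<Longrightarrow> - x \<in> weyl_ideal"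
  using weyl_ideal_mult_left[of x "- 1"] by simp

lemma weyl_relator_in_ideal: "weyl_relator \<in> weyl_ideal"
  using weyl_ideal.step[OF weyl_ideal.zero, of 1 1] by simp

definition weyl_rel :: "(weyl_word \<Rightarrow>\<^sub>0 'k::field) \<Rightarrow> (weyl_word \<Rightarrow>\<^sub>0 'k) \<Rightarrow> bool"
  where "weyl_rel x y \<longleftrightarrow> x - y \<in> weyl_ideal"

lemma equivp_weyl_rel: "equivp (weyl_rel :: (weyl_word \<Rightarrow>\<^sub>0 'k::field) \<Rightarrow> _)"
proof (rule equivpI)
  show "reflp (weyl_rel :: (weyl_word \<Rightarrow>\<^sub>0 'k) \<Rightarrow> _)"
    by (auto simp: reflp_def weyl_rel_def weyl_ideal.zero)
  show "symp (weyl_rel :: (weyl_word \<Rightarrow>\<^sub>0 'k) \<Rightarrow> _)"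
  proof (rule sympI)
    fix x y :: "weyl_word \<Rightarrow>\<^sub>0 'k"
    assume "weyl_rel x y"
    then show "weyl_rel y x"
      using weyl_ideal_uminus[of "x - y"] by (simp add: weyl_rel_def)
  qed
  show "transp (weyl_rel :: (weyl_word \<Rightarrow>\<^sub>0 'k) \<Rightarrow> _)"
  proof (rule transpI)
    fix x y z :: "weyl_word \<Rightarrow>\<^sub>0 'k"
    assume "weyl_rel x y" "weyl_rel y z"
    then show "weyl_rel x z"
      using weyl_ideal_add[of "y - z" "x - y"] by (simp add: weyl_rel_def)
  qed
qed


section \<open>Non-triviality\<close>

text \<open>
  The class \<^class>\<open>ring_1\<close> demands \<open>0 \<noteq> 1\<close>.  To see this for the quotient, let the free
  algebra act on polynomials, \<open>p\<close> as multiplication by the indeterminate and \<open>q\<close> as the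
  derivative.
\<close>

primrec gen_act :: "weyl_gen \<Rightarrow> 'k::field poly \<Rightarrow> 'k poly"
  where
    "gen_act Gen_p u = pCons 0 u"
  | "gen_act Gen_q u = pderiv u"

definition word_act :: "weyl_word \<Rightarrow> 'k::field poly \<Rightarrow> 'k poly"
  where "word_act w u = foldr gen_act (letters w) u"

definition free_act :: "(weyl_word \<Rightarrow>\<^sub>0 'k::field) \<Rightarrow> 'k poly \<Rightarrow> 'k poly"
  where "free_act x u = (\<Sum>w\<in>Poly_Mapping.keys x. smult (Poly_Mapping.lookup x w) (word_act w u))"

lemma gen_act_add: "gen_act g (u + v) = gen_act g u + gen_act g v"
  by (cases g) (simp_all add: pderiv_add)

lemma gen_act_smult: "gen_act g (smult c u) = smult c (gen_act g u)"
  by (cases g) (simp_all add: pderiv_smult)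

lemma word_act_add: "word_act w (u + v) = word_act w u + word_act w v"
proof -
  have "foldr gen_act gs (u + v) = foldr gen_act gs u + foldr gen_act gs v" for gs
    by (induction gs) (simp_all add: gen_act_add)
  then show ?thesis by (simp add: word_act_def)
qed

lemma word_act_smult: "word_act w (smult c u) = smult c (word_act w u)"
proof -
  have "foldr gen_act gs (smult c u) = smult c (foldr gen_act gs u)" for gs
    by (induction gs) (simp_all add: gen_act_smult)
  then show ?thesis by (simp add: word_act_def)
qed

lemma word_act_plus: "word_act (v + w) u = word_act v (word_act w u)"
  by (simp add: word_act_def plus_weyl_word_def)

lemma free_act_superset:
  assumes "finite A" "Poly_Mapping.keys x \<subseteq> A"
  shows "free_act x u = (\<Sum>w\<in>A. smult (Poly_Mapping.lookup x w) (word_act w u))"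
  unfolding free_act_def using assms
  by (intro sum.mono_neutral_left) (auto simp: in_keys_iff)

lemma free_act_plus: "free_act (x + y) u = free_act x u + free_act y u"
proof -
  let ?A = "Poly_Mapping.keys x \<union> Poly_Mapping.keys y"
  have "Poly_Mapping.keys (x + y) \<subseteq> ?A"
    by (rule Poly_Mapping.keys_add)
  then show ?thesis
    by (simp add: free_act_superset[of ?A] lookup_add smult_add_left sum.distrib)
qed

lemma free_act_zero: "free_act 0 u = 0"
  by (simp add: free_act_def)

lemma free_act_uminus: "free_act (- x) u = - free_act x u"
  using free_act_plus[of x "- x" u] by (simp add: free_act_zero eq_neg_iff_add_eq_0 add.commute)

lemma free_act_diff: "free_act (x - y) u = free_act x u - free_act y u"
  using free_act_plus[of x "- y" u] by (simp add: free_act_uminus)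

lemma free_act_single: "free_act (Poly_Mapping.single w c) u = smult c (word_act w u)"
  by (simp add: free_act_def)

lemma free_act_add_right: "free_act x (u + v) = free_act x u + free_act x v"
  by (simp add: free_act_def word_act_add smult_add_right sum.distrib)

lemma free_act_smult_right: "free_act x (smult c u) = smult c (free_act x u)"
proof -
  have "smult c (\<Sum>w\<in>A. f w) = (\<Sum>w\<in>A. smult c (f w))" for f :: "weyl_word \<Rightarrow> 'a poly" and A
    by (induction A rule: infinite_finite_induct) (simp_all add: smult_add_right)
  then show ?thesis by (simp add: free_act_def word_act_smult mult.commute)
qed

lemma free_act_zero_right: "free_act x 0 = 0"
  using free_act_smult_right[of x 0 0] by simp

lemma free_algebra_induct [case_names zero single plus]:
  assumes "P 0" and "\<And>w c. P (Poly_Mapping.single w c)"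
    and "\<And>x y. P x \<Longrightarrow> P y \<Longrightarrow> P (x + y)"
  shows "P (x :: weyl_word \<Rightarrow>\<^sub>0 'k::field)"
proof -
  have "P (\<Sum>w\<in>A. Poly_Mapping.single w (Poly_Mapping.lookup x w))" if "finite A" for A
    using that by (induction A rule: finite_induct) (auto intro: assms)
  moreover have "(\<Sum>w\<in>Poly_Mapping.keys x. Poly_Mapping.single w (Poly_Mapping.lookup x w)) = x"
    by (rule poly_mapping_eqI)
       (auto simp: lookup_sum lookup_single when_def in_keys_iff sum.delta')
  ultimately show ?thesis
    by (metis finite_keys)
qed

lemma free_act_mult: "free_act (x * y) u = free_act x (free_act y u)"
proof (induction x rule: free_algebra_induct)
  case (single v c)
  show ?case
    by (induction y rule: free_algebra_induct)
       (simp_all add: free_act_zero free_act_zero_right mult_single free_act_single word_act_plus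
          word_act_smult distrib_left free_act_plus word_act_add smult_add_right)
qed (simp_all add: free_act_zero distrib_right free_act_plus)

lemma free_act_one: "free_act 1 u = u"
  using free_act_single[of 0 1 u] unfolding single_one by (simp add: word_act_def zero_weyl_word_def)

lemma free_act_relator: "free_act weyl_relator u = 0"
  by (simp add: weyl_relator_def free_act_diff free_act_mult free_gen_def free_act_single
      free_act_one word_act_def pderiv_pCons)

lemma free_act_ideal: "x \<in> weyl_ideal \<Longrightarrow> free_act x u = 0"
  by (induction x rule: weyl_ideal.induct)
     (simp_all add: free_act_zero free_act_plus free_act_mult free_act_relator free_act_zero_right)

lemma one_notin_weyl_ideal: "1 \<notin> weyl_ideal"
  using free_act_ideal[of 1 1] by (auto simp: free_act_one)


section \<open>The first Weyl algebra\<close>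

quotient_type (overloaded) 'k weyl = "weyl_word \<Rightarrow>\<^sub>0 'k::field" / weyl_rel
  by (rule equivp_weyl_rel)

instantiation weyl :: (field) ring_1
begin

lift_definition zero_weyl :: "'a weyl" is 0 .

lift_definition one_weyl :: "'a weyl" is 1 .

lift_definition plus_weyl :: "'a weyl \<Rightarrow> 'a weyl \<Rightarrow> 'a weyl" is "(+)"
  unfolding weyl_rel_def by (metis add_diff_add weyl_ideal_add)

lift_definition uminus_weyl :: "'a weyl \<Rightarrow> 'a weyl" is uminus
  unfolding weyl_rel_def by (metis minus_diff_minus weyl_ideal_uminus)

lift_definition minus_weyl :: "'a weyl \<Rightarrow> 'a weyl \<Rightarrow> 'a weyl" is "(-)"
proof -
  fix a a' b b' :: "weyl_word \<Rightarrow>\<^sub>0 'a"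
  assume "weyl_rel a a'" "weyl_rel b b'"
  then have "(a - a') + - (b - b') \<in> weyl_ideal"
    unfolding weyl_rel_def by (intro weyl_ideal_add weyl_ideal_uminus)
  then show "weyl_rel (a - b) (a' - b')"
    by (simp add: weyl_rel_def algebra_simps)
qed

lift_definition times_weyl :: "'a weyl \<Rightarrow> 'a weyl \<Rightarrow> 'a weyl" is "(*)"
proof -
  fix a a' b b' :: "weyl_word \<Rightarrow>\<^sub>0 'a"
  assume "weyl_rel a a'" "weyl_rel b b'"
  then have "(a - a') * b + a' * (b - b') \<in> weyl_ideal"
    unfolding weyl_rel_def by (intro weyl_ideal_add weyl_ideal_mult_left weyl_ideal_mult_right)
  then show "weyl_rel (a * b) (a' * b')"
    by (simp add: weyl_rel_def algebra_simps)
qed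

instance
proof
  show "(0 :: 'a weyl) \<noteq> 1"
    by transfer (use one_notin_weyl_ideal weyl_ideal_uminus in \<open>fastforce simp: weyl_rel_def\<close>)
qed (transfer; simp add: weyl_rel_def weyl_ideal.zero algebra_simps)+

end

lift_definition weyl_p :: "'k::field weyl" is "free_gen Gen_p" .

lift_definition weyl_q :: "'k::field weyl" is "free_gen Gen_q" .

lift_definition weyl_scale :: "'k::field \<Rightarrow> 'k weyl \<Rightarrow> 'k weyl"
  is "\<lambda>c x. Poly_Mapping.single 0 c * x"
  unfolding weyl_rel_def by (metis right_diff_distrib weyl_ideal_mult_left)

lemma weyl_relation: "weyl_q * weyl_p - weyl_p * weyl_q = 1"
  by transfer (use weyl_relator_in_ideal in \<open>simp add: weyl_rel_def weyl_relator_def\<close>)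

interpretation weyl: vector_space weyl_scale
  by standard
     (transfer; simp add: weyl_rel_def weyl_ideal.zero algebra_simps single_add mult_single
        flip: mult.assoc)+

lemma single_central:
  "Poly_Mapping.single 0 c * x = x * Poly_Mapping.single (0 :: weyl_word) (c :: 'k::field)"
  by (induction x rule: free_algebra_induct) (simp_all add: mult_single algebra_simps)

lemma weyl_scale_mult_left: "weyl_scale c x * y = weyl_scale c (x * y)"
  by transfer (simp add: weyl_rel_def weyl_ideal.zero mult.assoc)

lemma weyl_scale_mult_right: "x * weyl_scale c y = weyl_scale c (x * y)"
  by transfer (metis equivp_reflp equivp_weyl_rel mult.assoc single_central)

definition weyl_hom :: "('k::field weyl \<Rightarrow> 'k weyl) \<Rightarrow> bool"
  where "weyl_hom \<phi> \<longleftrightarrow>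
    Vector_Spaces.linear weyl_scale weyl_scale \<phi> \<and>
    (\<forall>x y. \<phi> (x * y) = \<phi> x * \<phi> y) \<and> \<phi> 1 = 1"

definition weyl_Aut :: "('k::field weyl \<Rightarrow> 'k weyl) set"
  where "weyl_Aut = {\<phi>. weyl_hom \<phi> \<and> bij \<phi>}"


section \<open>Strictly nilpotent and strictly semisimple elements\<close>

definition ad :: "'k::field weyl \<Rightarrow> 'k weyl \<Rightarrow> 'k weyl"
  where "ad z w = z * w - w * z"

definition weyl_Ev :: "'k::field weyl \<Rightarrow> 'k set"
  where "weyl_Ev z = {c. \<exists>x. x \<noteq> 0 \<and> ad z x = weyl_scale c x}"

definition poly_ad :: "'k::field poly \<Rightarrow> 'k weyl \<Rightarrow> 'k weyl \<Rightarrow> 'k weyl"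
  where "poly_ad f z x = (\<Sum>i\<le>degree f. weyl_scale (coeff f i) ((ad z ^^ i) x))"

text \<open>
  Finite dimension is expressed by a finite spanning set, since \<^const>\<open>weyl.dim\<close> is \<open>0\<close> for
  infinite-dimensional spaces.
\<close>

definition weyl_F :: "'k::field weyl \<Rightarrow> 'k weyl set"
  where "weyl_F z = {x. \<exists>B. finite B \<and> weyl.span B = range (\<lambda>f. poly_ad f z x)}"

definition weyl_N :: "'k::field weyl \<Rightarrow> 'k weyl set"
  where "weyl_N z = {x. \<exists>m. (ad z ^^ m) x = 0}"

definition weyl_C :: "'k::field weyl \<Rightarrow> 'k weyl set"
  where "weyl_C z = {x. ad z x = 0}"

text \<open>
  The sum of eigenspaces is automatically direct, so only its underlying set of finite sums
  is recorded.
\<close>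

definition weyl_D :: "'k::field weyl \<Rightarrow> 'k weyl set"
  where "weyl_D z = {(\<Sum>c\<in>L. x c) | L x.
    finite L \<and> L \<subseteq> weyl_Ev z \<and> (\<forall>c\<in>L. ad z (x c) = weyl_scale c (x c))}"

definition strictly_nilpotent :: "'k::field weyl set" (\<open>\<Omega>\<^sub>1\<close>)
  where "\<Omega>\<^sub>1 = {z. weyl_Ev z = {0} \<and> weyl_C z \<subset> weyl_N z \<and> weyl_N z = UNIV}"

definition strictly_semisimple :: "'k::field weyl set" (\<open>\<Omega>\<^sub>2\<close>)
  where "\<Omega>\<^sub>2 = {z. {0} \<subset> weyl_Ev z \<and> weyl_D z = weyl_F z \<and> weyl_F z = UNIV}"

end

theory Submission
  imports Defs
begin

text \<open>
  Both strict nilpotency and strict semisimplicity force \<open>ad z\<close> to be locally finite, and an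
  injective homomorphism reflects this property; all homomorphisms are injective since the Weyl
  algebra is simple.  By Dixmier's Newton polygon argument a locally finite element is carried by an
  automorphism to a polynomial in \<open>q\<close> or to \<open>c p q + d\<close> with \<open>c \<noteq> 0\<close>: for positive weights, the
  leading form of \<open>z\<close> acts locally nilpotently through the Poisson bracket, hence it is a monomial in
  one variable or a multiple of a power of \<open>Y\<^sup>r - x X\<^sup>s\<close> with \<open>r = 1\<close> or \<open>s = 1\<close>, and a shear
  lowers the total degree.  Normalizing both \<open>w\<close> and \<open>\<phi> w\<close> leaves four cases.
  The two mixed ones are excluded by comparing nilpotent with diagonalizable derivations.  In the
  nilpotent case the image of \<open>q\<close> commutes with \<open>h(q)\<close>, hence is a polynomial in \<open>q\<close>; in the
  semisimple case the images of \<open>p\<close> and \<open>q\<close> are eigenvectors of \<open>ad (p q)\<close>.  Comparing degrees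
  then puts \<open>p\<close> and \<open>q\<close> into the image of \<open>\<phi>\<close>.
\<close>

section \<open>Homomorphisms of the Weyl algebra\<close>

text \<open>Only one further property of the given element is kept besides local finiteness: it is
  not central. This excludes the scalars, which lie in the image of every homomorphism. Since
  \<open>w\<close> and \<open>\<phi> w\<close> are normalized by different automorphisms, the
  homomorphism studied in the end is \<open>\<phi>\<close> composed with an automorphism on each
  side.

  The nilpotency of leading forms comes from a drift. If z has leading weight v, each application of
  \<open>ad z\<close> moves the top weight up by v - (\<rho> + \<sigma>), unless the Poisson bracket
  with the leading form vanishes, whereas local finiteness bounds the weights of an orbit. This
  needs \<rho> + \<sigma> < v. The situations that escape the inequality are normalized directly:
  total degree at most 2, and elements whose terms outside K[q] are multiples of p and p q. In all
  others the edge of the Newton polygon that leaves (0, d) dictates both the weights and the shear.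
  Algebraic closedness enters where a binary form is split into linear factors and where a quadratic
  form needs a root.\<close>

definition word_eval :: "'k::field weyl \<Rightarrow> 'k weyl \<Rightarrow> weyl_gen list \<Rightarrow> 'k weyl"
  where "word_eval a b gs = foldr (\<lambda>g y. (case g of Gen_p \<Rightarrow> a | Gen_q \<Rightarrow> b) * y) gs 1"

lemma word_eval_simps [simp]:
  "word_eval a b [] = 1"
  "word_eval a b (Gen_p # gs) = a * word_eval a b gs"
  "word_eval a b (Gen_q # gs) = b * word_eval a b gs"
  by (simp_all add: word_eval_def)

lemma word_eval_append: "word_eval a b (gs @ hs) = word_eval a b gs * word_eval a b hs"
proof (induction gs)
  case (Cons g gs)
  then show ?case by (cases g) (simp_all add: mult.assoc)
qed simp

definition free_eval :: "'k::field weyl \<Rightarrow> 'k weyl \<Rightarrow> (weyl_word \<Rightarrow>\<^sub>0 'k) \<Rightarrow> 'k weyl"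
  where "free_eval a b x =
    (\<Sum>w\<in>Poly_Mapping.keys x. weyl_scale (Poly_Mapping.lookup x w) (word_eval a b (letters w)))"

lemma free_eval_superset:
  assumes "finite A" "Poly_Mapping.keys x \<subseteq> A"
  shows "free_eval a b x = (\<Sum>w\<in>A. weyl_scale (Poly_Mapping.lookup x w) (word_eval a b (letters w)))"
  unfolding free_eval_def using assms
  by (intro sum.mono_neutral_left) (auto simp: in_keys_iff)

lemma free_eval_plus: "free_eval a b (x + y) = free_eval a b x + free_eval a b y"
proof -
  let ?A = "Poly_Mapping.keys x \<union> Poly_Mapping.keys y"
  have "Poly_Mapping.keys (x + y) \<subseteq> ?A"
    by (rule Poly_Mapping.keys_add)
  then show ?thesis
    by (simp add: free_eval_superset[of ?A] lookup_add weyl.scale_left_distrib sum.distrib)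
qed

lemma free_eval_0 [simp]: "free_eval a b 0 = 0"
  by (simp add: free_eval_def)

lemma free_eval_diff: "free_eval a b (x - y) = free_eval a b x - free_eval a b y"
  using free_eval_plus[of a b "x - y" y] by simp

lemma free_eval_single: "free_eval a b (Poly_Mapping.single w c) = weyl_scale c (word_eval a b (letters w))"
  by (simp add: free_eval_def)

lemma free_eval_1 [simp]: "free_eval a b 1 = 1"
  using free_eval_single[of a b 0 1] unfolding single_one by (simp add: zero_weyl_word_def)

lemma free_eval_mult: "free_eval a b (x * y) = free_eval a b x * free_eval a b y"
proof (induction x rule: free_algebra_induct)
  case (single v c)
  show ?case
    by (induction y rule: free_algebra_induct)
       (simp_all add: mult_single free_eval_single plus_weyl_word_def word_eval_append
          weyl_scale_mult_left weyl_scale_mult_right distrib_left free_eval_plus)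
qed (simp_all add: distrib_right free_eval_plus)

lemma free_eval_ideal:
  assumes "b * a - a * b = 1" "x \<in> weyl_ideal"
  shows "free_eval a b x = 0"
  using assms(2)
proof (induction rule: weyl_ideal.induct)
  case (step x c d)
  have "free_eval a b weyl_relator = 0"
    using assms(1)
    by (simp add: weyl_relator_def free_eval_diff free_eval_mult free_gen_def free_eval_single)
  with step show ?case by (simp add: free_eval_plus free_eval_mult)
qed simp

text \<open>Meaningful only if \<open>b * a - a * b = 1\<close>; otherwise it depends on the chosen representative.\<close>

definition weyl_subst :: "'k::field weyl \<Rightarrow> 'k weyl \<Rightarrow> 'k weyl \<Rightarrow> 'k weyl"
  where "weyl_subst a b z = free_eval a b (rep_weyl z)"

lemma weyl_subst_abs:
  assumes "b * a - a * b = 1"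
  shows "weyl_subst a b (abs_weyl x) = free_eval a b x"
proof -
  have "weyl_rel (rep_weyl (abs_weyl x)) x"
    by (rule Quotient3_rep_abs[OF Quotient3_weyl]) (simp add: equivp_reflp[OF equivp_weyl_rel])
  then have "free_eval a b (rep_weyl (abs_weyl x) - x) = 0"
    unfolding weyl_rel_def by (rule free_eval_ideal[OF assms])
  then show ?thesis by (simp add: weyl_subst_def free_eval_diff)
qed

lemma weyl_abs_cases: obtains x where "z = abs_weyl x"
  by (metis Quotient3_abs_rep Quotient3_weyl)

text \<open>This is the universal property of A_1: evaluation of words kills the relator because
  \<open>a\<close> and \<open>b\<close> satisfy the defining relation, so it descends to the
  quotient. The elementary automorphisms below arise in this way.\<close>

lemma
  fixes a b :: "'k::field weyl"
  assumes ba: "b * a - a * b = 1"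
  shows weyl_hom_subst: "weyl_hom (weyl_subst a b)"
    and weyl_subst_p: "weyl_subst a b weyl_p = a"
    and weyl_subst_q: "weyl_subst a b weyl_q = b"
proof -
  note abs = weyl_subst_abs[OF ba]
  have plus: "weyl_subst a b (x + y) = weyl_subst a b x + weyl_subst a b y" for x y
    by (cases x rule: weyl_abs_cases; cases y rule: weyl_abs_cases)
       (simp add: plus_weyl.abs_eq abs free_eval_plus)
  have mult: "weyl_subst a b (x * y) = weyl_subst a b x * weyl_subst a b y" for x y
    by (cases x rule: weyl_abs_cases; cases y rule: weyl_abs_cases)
       (simp add: times_weyl.abs_eq abs free_eval_mult)
  have scale: "weyl_subst a b (weyl_scale c x) = weyl_scale c (weyl_subst a b x)" for c x
    by (cases x rule: weyl_abs_cases)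
       (simp add: weyl_scale.abs_eq abs free_eval_mult free_eval_single zero_weyl_word_def
         weyl_scale_mult_left)
  have one: "weyl_subst a b 1 = 1"
    by (simp add: one_weyl.abs_eq abs)
  show "weyl_hom (weyl_subst a b)"
    unfolding weyl_hom_def
  proof (intro conjI allI)
    show "Vector_Spaces.linear weyl_scale weyl_scale (weyl_subst a b)"
      by unfold_locales (simp_all add: plus scale)
  qed (simp_all add: mult one)
  show "weyl_subst a b weyl_p = a" "weyl_subst a b weyl_q = b"
    by (simp_all add: weyl_p.abs_eq weyl_q.abs_eq abs free_gen_def free_eval_single)
qed

text \<open>Words span the algebra and grow by letters on the left, so left multiplication by the
  two generators suffices. The element 0 is reached by scaling 1 with 0.\<close>

lemma weyl_induct [case_names one scale plus p q]:
  assumes one: "P 1" and scale: "\<And>c x. P x \<Longrightarrow> P (weyl_scale c x)"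
    and plus: "\<And>x y. P x \<Longrightarrow> P y \<Longrightarrow> P (x + y)"
    and p: "\<And>x. P x \<Longrightarrow> P (weyl_p * x)" and q: "\<And>x. P x \<Longrightarrow> P (weyl_q * x)"
  shows "P (z :: 'k::field weyl)"
proof -
  obtain x where z: "z = abs_weyl x" by (rule weyl_abs_cases)
  have word: "P (abs_weyl (Poly_Mapping.single (Word gs) 1))" for gs
  proof (induction gs)
    case Nil
    have "abs_weyl (Poly_Mapping.single (Word []) 1) = (1 :: 'k weyl)"
      by (metis one_weyl.abs_eq single_one zero_weyl_word_def)
    with one show ?case by simp
  next
    case (Cons g gs)
    have "Poly_Mapping.single (Word (g # gs)) 1 =
        free_gen g * Poly_Mapping.single (Word gs) (1 :: 'k)"
      by (simp add: free_gen_def mult_single plus_weyl_word_def)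
    then have "abs_weyl (Poly_Mapping.single (Word (g # gs)) (1 :: 'k)) =
        abs_weyl (free_gen g) * abs_weyl (Poly_Mapping.single (Word gs) 1)"
      by (simp add: times_weyl.abs_eq)
    with Cons p q show ?case
      by (cases g) (simp_all flip: weyl_p.abs_eq weyl_q.abs_eq)
  qed
  have "P (abs_weyl x)"
  proof (induction x rule: free_algebra_induct)
    case zero
    show ?case using scale[OF one, of 0] by (simp flip: zero_weyl.abs_eq)
  next
    case (single w c)
    have "Poly_Mapping.single w c = Poly_Mapping.single 0 c * Poly_Mapping.single (Word (letters w)) 1"
      by (simp add: mult_single)
    then have "abs_weyl (Poly_Mapping.single w c) =
        weyl_scale c (abs_weyl (Poly_Mapping.single (Word (letters w)) 1))"
      by (simp add: weyl_scale.abs_eq)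
    with scale[OF word, of c "letters w"] show ?case by simp
  next
    case (plus x y)
    then show ?case using assms(3) by (simp flip: plus_weyl.abs_eq)
  qed
  with z show ?thesis by simp
qed

context
  fixes \<phi> :: "'k::field weyl \<Rightarrow> 'k weyl"
  assumes hom: "weyl_hom \<phi>"
begin

lemma weyl_hom_linear: "Vector_Spaces.linear weyl_scale weyl_scale \<phi>"
  using hom by (simp add: weyl_hom_def)

interpretation hom: Vector_Spaces.linear weyl_scale weyl_scale \<phi>
  by (rule weyl_hom_linear)

lemma weyl_hom_simps:
  "\<phi> (x + y) = \<phi> x + \<phi> y" "\<phi> (x - y) = \<phi> x - \<phi> y" "\<phi> (- x) = - \<phi> x"
  "\<phi> 0 = 0" "\<phi> 1 = 1" "\<phi> (x * y) = \<phi> x * \<phi> y" "\<phi> (weyl_scale c x) = weyl_scale c (\<phi> x)"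
  using hom by (simp_all add: weyl_hom_def hom.add hom.diff hom.neg hom.scale)

lemma weyl_hom_power: "\<phi> (x ^ n) = \<phi> x ^ n"
  by (induction n) (simp_all add: weyl_hom_simps)

lemma weyl_hom_ad: "\<phi> (ad z x) = ad (\<phi> z) (\<phi> x)"
  by (simp add: ad_def weyl_hom_simps)

lemma weyl_hom_ad_funpow: "\<phi> ((ad z ^^ n) x) = (ad (\<phi> z) ^^ n) (\<phi> x)"
  by (induction n) (simp_all add: weyl_hom_ad)

lemma weyl_hom_surjI:
  assumes "weyl_p \<in> range \<phi>" "weyl_q \<in> range \<phi>"
  shows "surj \<phi>"
proof -
  have "z \<in> range \<phi>" for z
  proof (induction z rule: weyl_induct)
    case one
    show ?case by (metis rangeI weyl_hom_simps(5))
  next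
    case (scale c x)
    then show ?case by (metis (no_types, lifting) image_iff rangeI weyl_hom_simps(7))
  next
    case (plus x y)
    then show ?case by (metis (no_types, lifting) image_iff rangeI weyl_hom_simps(1))
  next
    case (p x)
    with assms show ?case by (metis (no_types, lifting) image_iff rangeI weyl_hom_simps(6))
  next
    case (q x)
    with assms show ?case by (metis (no_types, lifting) image_iff rangeI weyl_hom_simps(6))
  qed
  then show ?thesis by blast
qed

end

lemma weyl_hom_comp:
  assumes "weyl_hom \<phi>" "weyl_hom \<psi>"
  shows "weyl_hom (\<phi> \<circ> \<psi>)"
  unfolding weyl_hom_def
proof (intro conjI)
  show "Vector_Spaces.linear weyl_scale weyl_scale (\<phi> \<circ> \<psi>)"
    by (rule Vector_Spaces.linear_compose) (use assms in \<open>auto intro: weyl_hom_linear\<close>)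
qed (use assms in \<open>simp_all add: weyl_hom_simps\<close>)

lemma weyl_hom_inv:
  assumes "weyl_hom \<alpha>" "bij \<alpha>"
  shows "weyl_hom (inv \<alpha>)"
proof -
  have inj: "\<alpha> x = \<alpha> y \<longleftrightarrow> x = y" for x y
    using assms(2) by (simp add: bij_def inj_eq)
  have [simp]: "\<alpha> (inv \<alpha> x) = x" for x
    using assms(2) by (simp add: bij_is_surj surj_f_inv_f)
  have 1: "inv \<alpha> (x + y) = inv \<alpha> x + inv \<alpha> y" "inv \<alpha> (x * y) = inv \<alpha> x * inv \<alpha> y"
    "inv \<alpha> (weyl_scale c x) = weyl_scale c (inv \<alpha> x)" "inv \<alpha> 1 = 1" for x y c
    by (subst inj[symmetric]; simp add: weyl_hom_simps[OF assms(1)])+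
  then show ?thesis
    unfolding weyl_hom_def by (intro conjI allI; (unfold_locales)?) auto
qed

lemma weyl_hom_eqI:
  assumes \<phi>: "weyl_hom \<phi>" and \<psi>: "weyl_hom \<psi>"
    and "\<phi> weyl_p = \<psi> weyl_p" "\<phi> weyl_q = \<psi> weyl_q"
  shows "\<phi> z = \<psi> z"
  by (induction z rule: weyl_induct)
     (simp_all add: weyl_hom_simps[OF \<phi>] weyl_hom_simps[OF \<psi>] assms(3,4))

lemma weyl_hom_id: "weyl_hom id"
  unfolding weyl_hom_def by (intro conjI allI; (unfold_locales)?) auto

lemma weyl_Aut_I:
  assumes \<phi>: "weyl_hom \<phi>" and \<psi>: "weyl_hom \<psi>"
    and "\<phi> (\<psi> weyl_p) = weyl_p" "\<phi> (\<psi> weyl_q) = weyl_q"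
    and "\<psi> (\<phi> weyl_p) = weyl_p" "\<psi> (\<phi> weyl_q) = weyl_q"
  shows "\<phi> \<in> weyl_Aut"
proof -
  have "(\<phi> \<circ> \<psi>) z = id z" "(\<psi> \<circ> \<phi>) z = id z" for z
    by (rule weyl_hom_eqI[OF weyl_hom_comp weyl_hom_id]; simp add: assms)+
  then have "bij \<phi>" by (intro o_bij[of \<psi>]) auto
  with \<phi> show ?thesis by (simp add: weyl_Aut_def)
qed

lemma weyl_Aut_comp: "\<phi> \<in> weyl_Aut \<Longrightarrow> \<psi> \<in> weyl_Aut \<Longrightarrow> \<phi> \<circ> \<psi> \<in> weyl_Aut"
  by (simp add: weyl_Aut_def weyl_hom_comp bij_comp)

lemma weyl_Aut_id: "id \<in> weyl_Aut"
  by (simp add: weyl_Aut_def weyl_hom_id)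

section \<open>Polynomials in one element, and elementary automorphisms\<close>

definition weyl_poly :: "'k::field poly \<Rightarrow> 'k weyl \<Rightarrow> 'k weyl"
  where "weyl_poly u z = fold_coeffs (\<lambda>c x. weyl_scale c 1 + z * x) u 0"

lemma weyl_poly_0 [simp]: "weyl_poly 0 z = 0"
  by (simp add: weyl_poly_def)

lemma weyl_poly_pCons [simp]: "weyl_poly (pCons c u) z = weyl_scale c 1 + z * weyl_poly u z"
  by (cases "u = 0 \<and> c = 0") (auto simp: weyl_poly_def)

lemma weyl_poly_1 [simp]: "weyl_poly 1 z = 1"
  by (simp add: one_pCons)

lemma weyl_poly_add: "weyl_poly (u + v) z = weyl_poly u z + weyl_poly v z"
  by (induction u v rule: poly_induct2) (simp_all add: weyl.scale_left_distrib algebra_simps)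

lemma weyl_poly_smult: "weyl_poly (smult c u) z = weyl_scale c (weyl_poly u z)"
  by (induction u) (simp_all add: weyl.scale_right_distrib weyl_scale_mult_right)

lemma weyl_poly_minus: "weyl_poly (- u) z = - weyl_poly u z"
  using weyl_poly_smult[of "-1" u z] by simp

lemma weyl_poly_mult: "weyl_poly (u * v) z = weyl_poly u z * weyl_poly v z"
  by (induction u)
     (simp_all add: weyl_poly_add weyl_poly_smult weyl_scale_mult_left algebra_simps)

lemma weyl_poly_commute: "weyl_poly u z * z = z * weyl_poly u z"
  by (induction u) (simp_all add: algebra_simps weyl_scale_mult_left weyl_scale_mult_right)

lemma weyl_hom_poly: "weyl_hom \<phi> \<Longrightarrow> \<phi> (weyl_poly u z) = weyl_poly u (\<phi> z)"
  by (induction u) (simp_all add: weyl_hom_simps)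

text \<open>Commutation with \<open>b\<close> is a derivation sending \<open>a\<close> to 1, so on
  polynomials in \<open>a\<close> it is differentiation.\<close>

lemma weyl_poly_derivation:
  assumes "b * a - a * b = 1"
  shows "b * weyl_poly u a = weyl_poly u a * b + weyl_poly (pderiv u) a"
proof (induction u)
  case (pCons c u)
  have "b * (a * y) = (b * a - a * b) * y + a * (b * y)" for y by (simp add: algebra_simps)
  then have "b * (a * weyl_poly u a) = weyl_poly u a + a * (b * weyl_poly u a)"
    using assms by simp
  with pCons show ?case
    by (simp add: pderiv_pCons weyl_poly_add algebra_simps weyl_scale_mult_left weyl_scale_mult_right)
qed simp

lemma weyl_relation': "weyl_q * weyl_p = weyl_p * weyl_q + 1"
  using weyl_relation by (simp add: algebra_simps)

lemma weyl_subst_Aut: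
  assumes "b * a - a * b = 1" "b' * a' - a' * b' = 1"
    and "weyl_subst a b a' = weyl_p" "weyl_subst a b b' = weyl_q"
    and "weyl_subst a' b' a = weyl_p" "weyl_subst a' b' b = weyl_q"
  shows "weyl_subst a b \<in> weyl_Aut"
  by (rule weyl_Aut_I[where \<psi> = "weyl_subst a' b'"])
     (use assms in \<open>simp_all add: weyl_hom_subst weyl_subst_p weyl_subst_q\<close>)

lemma shear_q_relation: "(weyl_q + weyl_poly u weyl_p) * weyl_p - weyl_p * (weyl_q + weyl_poly u weyl_p) = 1"
  by (simp add: algebra_simps weyl_relation' weyl_poly_commute)

lemma shear_p_relation: "weyl_q * (weyl_p + weyl_poly u weyl_q) - (weyl_p + weyl_poly u weyl_q) * weyl_q = 1"
  by (simp add: algebra_simps weyl_relation' weyl_poly_commute)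

lemma fourier_relation: "(- weyl_p) * weyl_q - weyl_q * (- weyl_p) = 1"
  by (simp add: weyl_relation')

lemma fourier_relation': "weyl_p * (- weyl_q) - (- weyl_q) * weyl_p = 1"
  by (simp add: weyl_relation')

text \<open>The inverse is the shear by \<open>- u\<close>, since both shears fix
  \<open>weyl_p\<close> and hence every polynomial in it.\<close>

lemma shear_q_Aut: "weyl_subst weyl_p (weyl_q + weyl_poly u weyl_p) \<in> weyl_Aut"
  using shear_q_relation[of u] shear_q_relation[of "- u"]
  by (intro weyl_subst_Aut[where a' = weyl_p and b' = "weyl_q + weyl_poly (- u) weyl_p"])
     (simp_all only: weyl_hom_simps[OF weyl_hom_subst] weyl_hom_poly[OF weyl_hom_subst]
        weyl_subst_p weyl_subst_q, simp_all add: weyl_poly_minus)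

lemma shear_p_Aut: "weyl_subst (weyl_p + weyl_poly u weyl_q) weyl_q \<in> weyl_Aut"
  using shear_p_relation[of u] shear_p_relation[of "- u"]
  by (intro weyl_subst_Aut[where b' = weyl_q and a' = "weyl_p + weyl_poly (- u) weyl_q"])
     (simp_all only: weyl_hom_simps[OF weyl_hom_subst] weyl_hom_poly[OF weyl_hom_subst]
        weyl_subst_p weyl_subst_q, simp_all add: weyl_poly_minus)

text \<open>The sign keeps the commutator of the two images equal to 1; the inverse sends p to -q
  and q to p.\<close>

lemma fourier_Aut: "weyl_subst weyl_q (- weyl_p) \<in> weyl_Aut"
proof (rule weyl_subst_Aut[where a' = "- weyl_q" and b' = weyl_p])
  note hom = weyl_hom_simps(3)[OF weyl_hom_subst[OF fourier_relation]]
    weyl_hom_simps(3)[OF weyl_hom_subst[OF fourier_relation']]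
  note subst = weyl_subst_p[OF fourier_relation] weyl_subst_q[OF fourier_relation]
    weyl_subst_p[OF fourier_relation'] weyl_subst_q[OF fourier_relation']
  show "weyl_subst weyl_q (- weyl_p) (- weyl_q) = weyl_p" "weyl_subst weyl_q (- weyl_p) weyl_p = weyl_q"
    "weyl_subst (- weyl_q) weyl_p weyl_q = weyl_p" "weyl_subst (- weyl_q) weyl_p (- weyl_p) = weyl_q"
    by (simp_all add: hom subst)
qed (rule fourier_relation fourier_relation')+

section \<open>Normally ordered symbols and weighted filtrations\<close>

text \<open>
  The symbol \<open>X\<^sup>i Y\<^sup>j\<close> stands for \<open>p\<^sup>i q\<^sup>j\<close>; \<open>X\<close> is the variable of the coefficient
  polynomials and \<open>Y\<close> the outer variable.
\<close>

abbreviation varX :: "'k::comm_ring_1 poly poly" where "varX \<equiv> [:[:0, 1:]:]"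
abbreviation varY :: "'k::comm_ring_1 poly poly" where "varY \<equiv> [:0, 1:]"

definition dX :: "'k::field_char_0 poly poly \<Rightarrow> 'k poly poly"
  where "dX f = map_poly pderiv f"

abbreviation dY :: "'k::field_char_0 poly poly \<Rightarrow> 'k poly poly"
  where "dY \<equiv> pderiv"

lemma coeff_dX: "coeff (dX f) j = pderiv (coeff f j)"
  by (simp add: dX_def coeff_map_poly)

lemma dX_0 [simp]: "dX 0 = 0" and dX_pCons: "dX (pCons a f) = pCons (pderiv a) (dX f)"
  by (simp_all add: poly_eq_iff coeff_dX coeff_pCons split: nat.split)

lemma dX_add: "dX (f + g) = dX f + dX g"
  by (simp add: poly_eq_iff coeff_dX pderiv_add)

lemma dX_minus: "dX (- f) = - dX f"
  by (simp add: poly_eq_iff coeff_dX pderiv_minus)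

lemma dX_smult: "dX (smult a f) = smult (pderiv a) f + smult a (dX f)"
  by (simp add: poly_eq_iff coeff_dX pderiv_mult algebra_simps)

lemma dX_mult: "dX (f * g) = dX f * g + f * dX g"
proof (induction f)
  case (pCons a f)
  then show ?case by (simp add: dX_pCons dX_add dX_smult algebra_simps)
qed simp

text \<open>The sign gives Y and X the bracket 1, in accordance with [q, p] = 1.\<close>

definition poisson :: "'k::field_char_0 poly poly \<Rightarrow> 'k poly poly \<Rightarrow> 'k poly poly"
  where "poisson f g = dY f * dX g - dX f * dY g"

lemma poisson_add_right: "poisson f (g + h) = poisson f g + poisson f h"
  by (simp add: poisson_def dX_add pderiv_add algebra_simps)

lemma poisson_add_left: "poisson (f + g) h = poisson f h + poisson g h"
  by (simp add: poisson_def dX_add pderiv_add algebra_simps)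

lemma poisson_mult_right: "poisson f (g * h) = poisson f g * h + g * poisson f h"
  by (simp add: poisson_def dX_mult pderiv_mult algebra_simps)

lemma poisson_self [simp]: "poisson f f = 0"
  by (simp add: poisson_def)

definition normal_order :: "'k::field_char_0 poly poly \<Rightarrow> 'k weyl"
  where "normal_order f = fold_coeffs (\<lambda>u x. weyl_poly u weyl_p + x * weyl_q) f 0"

lemma normal_order_0 [simp]: "normal_order 0 = 0"
  by (simp add: normal_order_def)

lemma normal_order_pCons [simp]:
  "normal_order (pCons u f) = weyl_poly u weyl_p + normal_order f * weyl_q"
  by (cases "f = 0 \<and> u = 0") (auto simp: normal_order_def)

lemma normal_order_add: "normal_order (f + g) = normal_order f + normal_order g"
  by (induction f g rule: poly_induct2) (simp_all add: weyl_poly_add algebra_simps)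

lemma normal_order_minus: "normal_order (- f) = - normal_order f"
  by (induction f) (simp_all add: weyl_poly_minus algebra_simps)

lemma normal_order_diff: "normal_order (f - g) = normal_order f - normal_order g"
  using normal_order_add[of f "- g"] by (simp add: normal_order_minus)

lemma normal_order_smult: "normal_order (smult u f) = weyl_poly u weyl_p * normal_order f"
  by (induction f) (simp_all add: weyl_poly_mult distrib_left mult.assoc)

lemma normal_order_scale: "weyl_scale c (normal_order f) = normal_order (smult [:c:] f)"
  by (simp add: normal_order_smult weyl_scale_mult_left)

lemma q_mult_normal_order: "weyl_q * normal_order f = normal_order (varY * f + dX f)"
proof (induction f)
  case (pCons u f)
  have "weyl_q * weyl_poly u weyl_p = weyl_poly u weyl_p * weyl_q + weyl_poly (pderiv u) weyl_p"
    by (rule weyl_poly_derivation[OF weyl_relation])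
  moreover have "weyl_q * (normal_order f * weyl_q) = normal_order (varY * f + dX f) * weyl_q"
    by (simp only: pCons.IH flip: mult.assoc)
  ultimately show ?case
    by (simp add: dX_pCons normal_order_add weyl_poly_add algebra_simps)
qed simp

lemma normal_order_mult_p: "normal_order f * weyl_p = normal_order (varX * f + dY f)"
proof (induction f)
  case (pCons u f)
  have "normal_order f * weyl_q * weyl_p = normal_order f * weyl_p * weyl_q + normal_order f"
    by (simp add: mult.assoc weyl_relation' distrib_left)
  with pCons show ?case
    by (simp add: normal_order_add weyl_poly_add weyl_poly_commute normal_order_smult pderiv_pCons algebra_simps)
qed simp

lemma p_mult_normal_order: "weyl_p * normal_order f = normal_order (varX * f)"
  by (simp add: normal_order_smult)

lemma normal_order_surj: "\<exists>f. z = normal_order f"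
proof (induction z rule: weyl_induct)
  case one
  have "1 = normal_order 1" by (simp add: one_pCons)
  then show ?case by blast
qed (metis normal_order_scale normal_order_add p_mult_normal_order q_mult_normal_order)+

text \<open>Commutators with p and q differentiate the symbol in Y and in X. The kernel of
  \<open>\<phi>\<close> is stable under them, and in characteristic zero they reduce a nonzero
  symbol to a nonzero scalar, which a unital homomorphism cannot kill. With the identity this yields
  uniqueness of normal forms, in general it yields injectivity.\<close>

lemma weyl_hom_normal_order_eq_0:
  assumes hom: "weyl_hom \<phi>" and 0: "\<phi> (normal_order f) = 0"
  shows "f = 0"
proof -
  have base: "u = 0" if "\<phi> (weyl_poly u weyl_p) = 0" for u
    using that
  proof (induction "degree u" arbitrary: u rule: less_induct)
    case less
    have "weyl_poly (pderiv u) weyl_p = weyl_q * weyl_poly u weyl_p - weyl_poly u weyl_p * weyl_q"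
      by (simp add: weyl_poly_derivation[OF weyl_relation])
    then have "\<phi> (weyl_poly (pderiv u) weyl_p) = 0"
      by (simp add: weyl_hom_simps[OF hom] less.prems)
    with less.hyps[of "pderiv u"] have "degree u = 0"
      by (cases "degree u") (auto simp: degree_pderiv pderiv_eq_0_iff)
    then obtain c where u: "u = [:c:]" by (rule degree_eq_zeroE)
    with less.prems have "weyl_scale c (1 :: 'a weyl) = 0"
      by (simp add: weyl_hom_simps[OF hom])
    with u show ?case by simp
  qed
  from 0 show ?thesis
  proof (induction "degree f" arbitrary: f rule: less_induct)
    case less
    have "normal_order (dY f) = normal_order f * weyl_p - weyl_p * normal_order f"
      by (simp add: normal_order_mult_p p_mult_normal_order normal_order_add)
    then have "\<phi> (normal_order (dY f)) = 0"
      by (simp add: weyl_hom_simps[OF hom] less.prems)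
    with less.hyps[of "dY f"] have "degree f = 0"
      by (cases "degree f") (auto simp: degree_pderiv pderiv_eq_0_iff)
    then obtain u where u: "f = [:u:]" by (rule degree_eq_zeroE)
    with less.prems base[of u] show ?case by (simp add: weyl_hom_simps[OF hom])
  qed
qed

lemma normal_order_eq_iff [simp]: "normal_order f = normal_order g \<longleftrightarrow> f = g"
  using weyl_hom_normal_order_eq_0[OF weyl_hom_id, of "f - g"] by (auto simp: normal_order_diff)

lemma normal_order_eq_0_iff [simp]: "normal_order f = 0 \<longleftrightarrow> f = 0"
  using normal_order_eq_iff[of f 0] by (simp del: normal_order_eq_iff)

lemma weyl_hom_inj:
  assumes "weyl_hom (\<phi> :: 'k::field_char_0 weyl \<Rightarrow> _)"
  shows "inj \<phi>"
proof (rule injI)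
  fix x y assume "\<phi> x = \<phi> y"
  moreover obtain f where "x - y = normal_order f" using normal_order_surj by blast
  ultimately have "f = 0"
    using weyl_hom_normal_order_eq_0[OF assms, of f] weyl_hom_simps(2)[OF assms, of x y] by simp
  with \<open>x - y = normal_order f\<close> show "x = y" by simp
qed

text \<open>The coefficient of X^i Y^j: the exponent of p comes first although Y is the outer
  variable.\<close>

definition cf :: "'k::zero poly poly \<Rightarrow> nat \<Rightarrow> nat \<Rightarrow> 'k"
  where "cf f i j = coeff (coeff f j) i"

lemma cf_0 [simp]: "cf 0 i j = 0"
  and cf_add: "cf (f + g) i j = cf f i j + cf g i j"
  and cf_minus: "cf (- f') i j = - cf f' i j"
  and cf_smult: "cf (smult [:c:] f'') i j = c * cf f'' i j"
  by (simp_all add: cf_def)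

lemma cf_eqI: "(\<And>i j. cf f i j = cf g i j) \<Longrightarrow> f = g"
  by (simp add: cf_def poly_eq_iff)

lemma cf_dY: "cf (dY f) i j = of_nat (Suc j) * cf f i (Suc j)"
  by (simp add: cf_def coeff_pderiv of_nat_poly flip: of_nat_Suc)

lemma cf_dX: "cf (dX f) i j = of_nat (Suc i) * cf f (Suc i) j"
  by (simp add: cf_def coeff_dX coeff_pderiv)

lemma cf_dX_nonzeroD: "cf (dX f) i j \<noteq> 0 \<Longrightarrow> cf f (Suc i) j \<noteq> 0"
  by (auto simp: cf_dX)

lemma cf_dY_nonzeroD: "cf (dY f) i j \<noteq> 0 \<Longrightarrow> cf f i (Suc j) \<noteq> 0"
  by (auto simp: cf_dY)

definition bimonom :: "'k::zero \<Rightarrow> nat \<Rightarrow> nat \<Rightarrow> 'k poly poly"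
  where "bimonom c i j = monom (monom c i) j"

lemma cf_bimonom: "cf (bimonom c i j) k l = (if k = i \<and> l = j then c else 0)"
  by (simp add: cf_def bimonom_def)

lemma bimonom_eq_0_iff [simp]: "bimonom c i j = 0 \<longleftrightarrow> c = 0"
  by (simp add: bimonom_def)

lemma varX_eq: "varX = bimonom 1 1 0" and varY_eq: "varY = bimonom 1 0 1"
  by (simp_all add: bimonom_def monom_Suc monom_0 one_pCons)

lemma bimonom_mult: "bimonom c i j * bimonom d k l = bimonom (c * d) (i + k) (j + l)"
  by (simp add: bimonom_def mult_monom)

lemma finite_cf_support: "finite {(i, j). cf f i j \<noteq> 0}"
proof (rule finite_subset)
  show "{(i, j). cf f i j \<noteq> 0} \<subseteq> (\<Union>j\<le>degree f. {..degree (coeff f j)} \<times> {j})"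
    by (auto simp: cf_def le_degree) (metis coeff_0 le_degree)
qed simp

text \<open>The monomial case is limited to the terms of \<open>f\<close> itself, so that a bound on
  the support of \<open>f\<close> remains available there.\<close>

lemma poly2_induct [case_names zero monom add]:
  assumes "P 0"
    and "\<And>i j. cf f i j \<noteq> 0 \<Longrightarrow> P (bimonom (cf f i j) i j)"
    and "\<And>g h. P g \<Longrightarrow> P h \<Longrightarrow> P (g + h)"
  shows "P (f :: 'k::comm_monoid_add poly poly)"
proof -
  let ?S = "{(i, j). cf f i j \<noteq> 0}"
  have sum: "P (\<Sum>(i,j)\<in>S. bimonom (cf f i j) i j)" if "finite S" "S \<subseteq> ?S" for S
    using that
  proof (induction S)
    case (insert s S)
    then show ?case using assms(2)[of "fst s" "snd s"] assms(3) by (auto simp: case_prod_unfold)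
  qed (use assms(1) in simp)
  have cf_sum: "cf (\<Sum>s\<in>S. h s) k l = (\<Sum>s\<in>S. cf (h s) k l)"
    for S :: "(nat \<times> nat) set" and h :: "nat \<times> nat \<Rightarrow> 'k poly poly" and k l
    by (simp add: cf_def coeff_sum)
  have "(\<Sum>(i,j)\<in>?S. bimonom (cf f i j) i j) = f"
  proof (rule cf_eqI)
    fix k l
    have "cf (\<Sum>(i,j)\<in>?S. bimonom (cf f i j) i j) k l =
        (\<Sum>s\<in>?S. if s = (k, l) then cf f k l else 0)"
      unfolding cf_sum by (intro sum.cong) (auto simp: cf_bimonom split: if_splits)
    also have "\<dots> = cf f k l"
      using finite_cf_support[of f] by simp
    finally show "cf (\<Sum>(i,j)\<in>?S. bimonom (cf f i j) i j) k l = cf f k l" .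
  qed
  with sum[OF finite_cf_support[of f] order_refl] show ?thesis by simp
qed

lemma cf_mult_nonzeroE:
  assumes "cf (f * g) i j \<noteq> 0"
  obtains a b where "a \<le> i" "b \<le> j" "cf f a b \<noteq> 0" "cf g (i - a) (j - b) \<noteq> 0"
proof -
  have "(\<Sum>b\<le>j. coeff (coeff f b * coeff g (j - b)) i) \<noteq> 0"
    using assms by (simp add: cf_def coeff_mult[of f g] coeff_sum)
  then obtain b where "b \<le> j" "coeff (coeff f b * coeff g (j - b)) i \<noteq> 0"
    by (metis (no_types, lifting) atMost_iff sum.neutral)
  moreover from this obtain a where "a \<le> i" "cf f a b * cf g (i - a) (j - b) \<noteq> 0"
    unfolding cf_def coeff_mult[of "coeff f b"] by (metis (no_types, lifting) atMost_iff sum.neutral)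
  ultimately show thesis using that by (metis mult_zero_left mult_zero_right)
qed

locale weights =
  fixes \<rho> \<sigma> :: int
  assumes pos: "0 < \<rho> + \<sigma>"
begin

definition wle :: "int \<Rightarrow> 'k::field_char_0 poly poly \<Rightarrow> bool"
  where "wle n f \<longleftrightarrow> (\<forall>i j. cf f i j \<noteq> 0 \<longrightarrow> \<rho> * int i + \<sigma> * int j \<le> n)"

definition whom :: "int \<Rightarrow> 'k::field_char_0 poly poly \<Rightarrow> bool"
  where "whom n f \<longleftrightarrow> (\<forall>i j. cf f i j \<noteq> 0 \<longrightarrow> \<rho> * int i + \<sigma> * int j = n)"

lemma wleI: "(\<And>i j. cf f i j \<noteq> 0 \<Longrightarrow> \<rho> * int i + \<sigma> * int j \<le> n) \<Longrightarrow> wle n f"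
  and wleD: "wle n f \<Longrightarrow> cf f i j \<noteq> 0 \<Longrightarrow> \<rho> * int i + \<sigma> * int j \<le> n"
  by (simp_all add: wle_def)

lemma whomI: "(\<And>i j. cf f i j \<noteq> 0 \<Longrightarrow> \<rho> * int i + \<sigma> * int j = n) \<Longrightarrow> whom n f"
  and whomD: "whom n f \<Longrightarrow> cf f i j \<noteq> 0 \<Longrightarrow> \<rho> * int i + \<sigma> * int j = n"
  by (simp_all add: whom_def)

lemma wle_0 [simp]: "wle n 0" and whom_0 [simp]: "whom n 0"
  by (simp_all add: wle_def whom_def)

lemma wle_add: "wle n f \<Longrightarrow> wle n g \<Longrightarrow> wle n (f + g)"
  unfolding wle_def cf_add by (metis add.right_neutral)

lemma whom_add: "whom n f \<Longrightarrow> whom n g \<Longrightarrow> whom n (f + g)"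
  unfolding whom_def cf_add by (metis add.right_neutral)

lemma wle_minus: "wle n f \<Longrightarrow> wle n (- f)" and whom_minus: "whom n f \<Longrightarrow> whom n (- f)"
  by (simp_all add: wle_def whom_def cf_minus)

lemma wle_diff: "wle n f \<Longrightarrow> wle n g \<Longrightarrow> wle n (f - g)"
  using wle_add[of n f "- g"] by (simp add: wle_minus)

lemma whom_diff: "whom n f \<Longrightarrow> whom n g \<Longrightarrow> whom n (f - g)"
  using whom_add[of n f "- g"] by (simp add: whom_minus)

lemma wle_mono: "wle m f \<Longrightarrow> m \<le> n \<Longrightarrow> wle n f"
  by (force simp: wle_def)

lemma whom_imp_wle: "whom n f \<Longrightarrow> wle n f"
  by (simp add: wle_def whom_def)

lemma wle_mult: "wle m f \<Longrightarrow> wle n g \<Longrightarrow> wle (m + n) (f * g)"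
  unfolding wle_def
  by (safe elim!: cf_mult_nonzeroE)
     (smt (verit, best) distrib_left le_add_diff_inverse of_nat_add)

lemma whom_mult: "whom m f \<Longrightarrow> whom n g \<Longrightarrow> whom (m + n) (f * g)"
  unfolding whom_def
  by (safe elim!: cf_mult_nonzeroE)
     (smt (verit, best) distrib_left le_add_diff_inverse of_nat_add)

lemma wle_dX: "wle n f \<Longrightarrow> wle (n - \<rho>) (dX f)" and whom_dX: "whom n f \<Longrightarrow> whom (n - \<rho>) (dX f)"
  and wle_dY: "wle n f \<Longrightarrow> wle (n - \<sigma>) (dY f)" and whom_dY: "whom n f \<Longrightarrow> whom (n - \<sigma>) (dY f)"
  by (intro wleI whomI; (drule cf_dX_nonzeroD | drule cf_dY_nonzeroD); (drule (1) wleD | drule (1) whomD);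
      simp add: algebra_simps)+

lemma wle_bimonom: "wle n (bimonom c i j) \<longleftrightarrow> c = 0 \<or> \<rho> * int i + \<sigma> * int j \<le> n"
  and whom_bimonom: "whom n (bimonom c i j) \<longleftrightarrow> c = 0 \<or> \<rho> * int i + \<sigma> * int j = n"
  by (auto simp: wle_def whom_def cf_bimonom)

lemma wle_poisson: "wle m f \<Longrightarrow> wle n g \<Longrightarrow> wle (m + n - (\<rho> + \<sigma>)) (poisson f g)"
  using wle_mult[OF wle_dY wle_dX, of m f n g] wle_mult[OF wle_dX wle_dY, of m f n g]
  by (simp add: poisson_def wle_diff algebra_simps)

lemma whom_poisson: "whom m f \<Longrightarrow> whom n g \<Longrightarrow> whom (m + n - (\<rho> + \<sigma>)) (poisson f g)"
  using whom_mult[OF whom_dY whom_dX, of m f n g] whom_mult[OF whom_dX whom_dY, of m f n g]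
  by (simp add: poisson_def whom_diff algebra_simps)

lemma wle_decompose:
  assumes "wle n f"
  obtains g h where "f = g + h" "whom n g" "wle (n - 1) h"
proof -
  have "\<exists>g h. f = g + h \<and> whom n g \<and> wle (n - 1) h"
  proof (induction f rule: poly2_induct)
    case (monom i j)
    with assms consider "\<rho> * int i + \<sigma> * int j = n" | "\<rho> * int i + \<sigma> * int j \<le> n - 1"
      unfolding wle_def by force
    then show ?case
    proof cases
      case 1
      then have "bimonom (cf f i j) i j = bimonom (cf f i j) i j + 0 \<and>
          whom n (bimonom (cf f i j) i j) \<and> wle (n - 1) (0 :: 'a poly poly)"
        by (simp add: whom_bimonom)
      then show ?thesis by blast
    next
      case 2
      then have "bimonom (cf f i j) i j = 0 + bimonom (cf f i j) i j \<and>
          whom n (0 :: 'a poly poly) \<and> wle (n - 1) (bimonom (cf f i j) i j)"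
        by (simp add: wle_bimonom)
      then show ?thesis by blast
    qed
  next
    case (add g h)
    then obtain g1 g2 h1 h2 where "g = g1 + g2" "h = h1 + h2"
      "whom n g1" "whom n h1" "wle (n - 1) g2" "wle (n - 1) h2" by blast
    then have "g + h = (g1 + h1) + (g2 + h2)" "whom n (g1 + h1)" "wle (n - 1) (g2 + h2)"
      by (simp_all add: whom_add wle_add)
    then show ?case by blast
  qed (metis add_0 wle_0 whom_0)
  with that show thesis by blast
qed

lemma whom_wle_eq_0: "whom n f \<Longrightarrow> wle m f \<Longrightarrow> m < n \<Longrightarrow> f = 0"
  by (rule cf_eqI) (force simp: whom_def wle_def)

lemma exists_wle: "\<exists>n. wle n f"
proof (induction f rule: poly2_induct)
  case (monom i j)
  show ?case using wle_bimonom by blast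
next
  case (add g h)
  then obtain m n where "wle m g" "wle n h" by blast
  then have "wle (max m n) (g + h)" by (intro wle_add) (auto elim: wle_mono)
  then show ?case by blast
qed simp

text \<open>
  The remainder \<open>r\<close> collects the contractions of order at least two, each of which removes
  one \<open>X\<close> and one \<open>Y\<close>.
\<close>

lemma normal_order_mult:
  assumes "wle m f" "wle n g"
  shows "\<exists>r. wle (m + n - 2 * (\<rho> + \<sigma>)) r \<and>
    normal_order f * normal_order g = normal_order (f * g + dY f * dX g + r)"
  using assms
proof (induction f arbitrary: m n g)
  case (pCons u f)
  have u: "wle m [:u:]"
  proof (rule wleI)
    fix i j assume "cf [:u:] i j \<noteq> 0"
    then have "j = 0" "cf (pCons u f) i 0 \<noteq> 0"
      by (auto simp: cf_def coeff_pCons split: nat.splits)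
    with wleD[OF pCons.prems(1), of i 0] show "\<rho> * int i + \<sigma> * int j \<le> m" by simp
  qed
  have f: "wle (m - \<sigma>) f"
  proof (rule wleI)
    fix i j assume "cf f i j \<noteq> 0"
    then have "cf (pCons u f) i (Suc j) \<noteq> 0" by (simp add: cf_def)
    with wleD[OF pCons.prems(1), of i "Suc j"] show "\<rho> * int i + \<sigma> * int j \<le> m - \<sigma>"
      by (simp add: algebra_simps)
  qed
  \<comment> \<open>The symbol of q times \<open>normal_order g\<close>: the factor q split off from
    the left operand is moved onto \<open>g\<close>, which is why \<open>g\<close> is arbitrary in
    the induction.\<close>
  let ?g = "varY * g + dX g"
  let ?b = "m + n - 2 * (\<rho> + \<sigma>)"
  have g: "wle (n + \<sigma>) ?g"
  proof (rule wle_add)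
    have "wle \<sigma> varY" unfolding varY_eq wle_bimonom by simp
    with wle_mult[OF this pCons.prems(2)] show "wle (n + \<sigma>) (varY * g)" by (simp add: add.commute)
    show "wle (n + \<sigma>) (dX g)"
      using wle_dX[OF pCons.prems(2)] by (rule wle_mono) (use pos in simp)
  qed
  from pCons.IH[OF f g] obtain r where r: "wle ?b r"
    "normal_order f * normal_order ?g = normal_order (f * ?g + dY f * dX ?g + r)"
    by auto
  have "wle ?b (dY f * dX (dX g) + r)"
    using wle_mult[OF wle_dY[OF f] wle_dX[OF wle_dX[OF pCons.prems(2)]]] r(1)
    by (intro wle_add) (simp_all add: algebra_simps)
  moreover have "normal_order (pCons u f) * normal_order g =
      normal_order (pCons u f * g + dY (pCons u f) * dX g + (dY f * dX (dX g) + r))"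
  proof -
    have "normal_order (pCons u f) * normal_order g =
        normal_order (smult u g) + normal_order f * (weyl_q * normal_order g)"
      by (simp add: normal_order_smult distrib_right mult.assoc)
    also have "\<dots> = normal_order (smult u g + (f * ?g + dY f * dX ?g + r))"
      by (simp only: q_mult_normal_order r(2) normal_order_add[of "smult u g"])
    also have "smult u g + (f * ?g + dY f * dX ?g + r) =
        pCons u f * g + dY (pCons u f) * dX g + (dY f * dX (dX g) + r)"
    proof -
      have "pCons u f = [:u:] + varY * f" "smult u g = [:u:] * g" by simp_all
      moreover have "dY (pCons u f) = f + varY * dY f" by (simp add: pderiv_pCons)
      moreover have "dX ?g = varY * dX g + dX (dX g)"
        by (simp only: dX_add dX_mult) (simp add: dX_pCons)
      ultimately show ?thesis by (simp only: algebra_simps)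
    qed
    finally show ?thesis .
  qed
  ultimately show ?case by blast
qed auto

text \<open>The commutative products cancel in the commutator, the single contractions combine to
  the Poisson bracket, and the rest is absorbed in the remainder.\<close>

lemma normal_order_commutator:
  assumes "wle m f" "wle n g"
  shows "\<exists>r. wle (m + n - 2 * (\<rho> + \<sigma>)) r \<and>
    ad (normal_order f) (normal_order g) = normal_order (poisson f g + r)"
proof -
  from normal_order_mult[OF assms] normal_order_mult[OF assms(2,1)] obtain r s where
    r: "wle (m + n - 2 * (\<rho> + \<sigma>)) r"
      "normal_order f * normal_order g = normal_order (f * g + dY f * dX g + r)"
    and s: "wle (m + n - 2 * (\<rho> + \<sigma>)) s"
      "normal_order g * normal_order f = normal_order (g * f + dY g * dX f + s)"
    by (auto simp: add.commute)
  have "ad (normal_order f) (normal_order g) = normal_order (poisson f g + (r - s))"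
    by (simp add: ad_def r(2) s(2) poisson_def algebra_simps flip: normal_order_diff)
  with wle_diff[OF r(1) s(1)] show ?thesis by blast
qed

end

section \<open>Locally nilpotent derivations and leading forms\<close>

locale locally_nilpotent_derivation =
  fixes D :: "'a::{idom, ring_char_0} \<Rightarrow> 'a"
  assumes add: "D (a + b) = D a + D b"
    and mult: "D (a * b) = D a * b + a * D b"
    and nilpotent: "\<exists>k. (D ^^ k) a = 0"

context
  fixes D :: "'a::{idom, ring_char_0} \<Rightarrow> 'a"
  assumes add: "D (a + b) = D a + D b"
    and mult: "D (a * b) = D a * b + a * D b"
begin

lemma derivation_0: "D 0 = 0"
  using add[of 0 0] by simp

lemma derivation_funpow_0: "(D ^^ k) 0 = 0"
  by (induction k) (simp_all add: derivation_0)

lemma derivation_funpow_add: "(D ^^ k) (a + b) = (D ^^ k) a + (D ^^ k) b"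
  by (induction k) (simp_all add: add)

lemma derivation_of_nat: "D (of_nat n) = 0"
proof -
  have "D 1 = 0" using mult[of 1 1] by simp
  then show ?thesis by (induction n) (simp_all add: derivation_0 add)
qed

lemma derivation_funpow_eq_0_mono:
  assumes "(D ^^ k) a = 0" "k \<le> n"
  shows "(D ^^ n) a = 0"
proof -
  from assms(2) have "(D ^^ n) a = (D ^^ (n - k)) ((D ^^ k) a)"
    by (simp flip: funpow_add[THEN fun_cong, unfolded o_apply])
  with assms(1) show ?thesis by (simp add: derivation_funpow_0)
qed

lemma derivation_power: "D (a ^ n) = of_nat n * a ^ (n - 1) * D a"
proof (induction n)
  case 0
  show ?case using derivation_of_nat[of 1] by simp
next
  case (Suc n)
  then show ?case by (cases n) (simp_all add: mult algebra_simps)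
qed

text \<open>In the Leibniz expansion of order \<open>k + l\<close> only one term survives, the one
  that differentiates \<open>a\<close> exactly \<open>k\<close> times and \<open>b\<close> exactly
  \<open>l\<close> times. The induction is Pascal's rule.\<close>

lemma derivation_funpow_top:
  assumes "(D ^^ Suc k) a = 0" "(D ^^ Suc l) b = 0"
  shows "(D ^^ (k + l)) (a * b) = of_nat ((k + l) choose k) * ((D ^^ k) a * (D ^^ l) b)"
  using assms
proof (induction "k + l" arbitrary: k l a b)
  case (Suc n)
  have step: "(D ^^ (k + l)) (a * b) = (D ^^ n) (D a * b) + (D ^^ n) (a * D b)"
    by (simp flip: Suc.hyps(2) add: funpow_swap1 mult derivation_funpow_add)
  have A: "(D ^^ n) (D a * b) = of_nat (n choose k') * ((D ^^ k) a * (D ^^ l) b)" if "k = Suc k'" for k'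
    using Suc.hyps(1)[of k' l "D a" b] Suc.hyps(2) Suc.prems that by (simp add: funpow_swap1)
  have B: "(D ^^ n) (a * D b) = of_nat (n choose k) * ((D ^^ k) a * (D ^^ l) b)" if "l = Suc l'" for l'
    using Suc.hyps(1)[of k l' a "D b"] Suc.hyps(2) Suc.prems that by (simp add: funpow_swap1)
  show ?case
  proof (cases k)
    case 0
    then obtain l' where "l = Suc l'" using Suc.hyps(2) by (cases l) auto
    with 0 Suc.prems B[OF this] step show ?thesis by (simp add: derivation_funpow_0)
  next
    case k: (Suc k')
    show ?thesis
    proof (cases l)
      case 0
      with k Suc.hyps(2) have "n = k'" by simp
      with 0 k Suc.prems A[OF k] step show ?thesis by (simp add: derivation_funpow_0)
    next
      case l: (Suc l')
      have "(k + l) choose k = (n choose k') + (n choose k)"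
        using k Suc.hyps(2) by (metis binomial_Suc_Suc)
      with A[OF k] B[OF l] step show ?thesis by (simp add: distrib_right)
    qed
  qed
qed simp

lemma derivation_nilpotent_mult:
  assumes "(D ^^ k) a = 0" "(D ^^ l) b = 0"
  shows "\<exists>n. (D ^^ n) (a * b) = 0"
proof -
  have a: "(D ^^ Suc k) a = 0" and b: "(D ^^ Suc l) b = 0"
    using assms by (simp_all add: derivation_0)
  have "(D ^^ (k + l)) (a * b) = 0"
    unfolding derivation_funpow_top[OF a b] using assms by simp
  then show ?thesis by blast
qed

end

context locally_nilpotent_derivation
begin

lemmas D_0 = derivation_0[of D, OF add mult]
lemmas D_funpow_eq_0_mono = derivation_funpow_eq_0_mono[of D, OF add mult]

lemma diff: "D (a - b) = D a - D b"
  using add[of "a - b" b] by simp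

text \<open>The degree function of a locally nilpotent derivation, given as a relation so that 0 has
  no degree.\<close>

definition has_deg :: "nat \<Rightarrow> 'a \<Rightarrow> bool"
  where "has_deg k a \<longleftrightarrow> (D ^^ k) a \<noteq> 0 \<and> (D ^^ Suc k) a = 0"

lemma has_deg_unique: "has_deg k a \<Longrightarrow> has_deg l a \<Longrightarrow> k = l"
  unfolding has_deg_def by (metis D_funpow_eq_0_mono Suc_leI linorder_neqE_nat)

lemma has_deg_exists:
  assumes "a \<noteq> 0"
  shows "\<exists>k. has_deg k a"
proof -
  define k where "k = (LEAST k. (D ^^ k) a = 0)"
  have "(D ^^ k) a = 0" unfolding k_def using nilpotent by (rule LeastI_ex)
  with assms obtain m where m: "k = Suc m" by (cases k) auto
  have "(D ^^ m) a \<noteq> 0" using not_less_Least[of m "\<lambda>k. (D ^^ k) a = 0"] m by (auto simp: k_def)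
  with \<open>(D ^^ k) a = 0\<close> m show ?thesis by (auto simp: has_deg_def)
qed

lemma has_deg_0_iff: "has_deg 0 a \<longleftrightarrow> a \<noteq> 0 \<and> D a = 0"
  by (simp add: has_deg_def)

text \<open>The top term of the Leibniz expansion is a binomial coefficient times two nonzero
  elements of the kernel; in a domain of characteristic zero it is nonzero, and one more application
  of \<open>D\<close> kills it.\<close>

lemma has_deg_mult:
  assumes "has_deg k a" "has_deg l b"
  shows "has_deg (k + l) (a * b)"
proof -
  have *: "(D ^^ (k + l)) (a * b) = of_nat ((k + l) choose k) * ((D ^^ k) a * (D ^^ l) b)"
    using assms by (intro derivation_funpow_top add mult) (auto simp: has_deg_def)
  have "(D ^^ Suc (k + l)) (a * b) = 0"
    using assms by (simp add: * mult derivation_of_nat[of D, OF add mult] has_deg_def)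
  with * assms show ?thesis by (simp add: has_deg_def)
qed

lemma has_deg_power: "has_deg k a \<Longrightarrow> has_deg (n * k) (a ^ n)"
proof (induction n)
  case 0
  show ?case using derivation_of_nat[of D, OF add mult, of 1] by (simp add: has_deg_0_iff)
next
  case (Suc n)
  then show ?case using has_deg_mult[of k a "n * k" "a ^ n"] by simp
qed

lemma has_deg_D: "has_deg (Suc k) a \<Longrightarrow> has_deg k (D a)"
  by (simp add: has_deg_def funpow_swap1)

text \<open>The kernel is factorially closed: degrees are additive natural numbers, and the product
  has degree 0.\<close>

lemma kernel_factor:
  assumes "D (a * b) = 0" "a * b \<noteq> 0"
  shows "D a = 0"
proof -
  obtain k l where kl: "has_deg k a" "has_deg l b"
    using has_deg_exists[of a] has_deg_exists[of b] assms(2) by auto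
  have "has_deg 0 (a * b)" using assms by (simp add: has_deg_0_iff)
  with has_deg_mult[OF kl] have "k + l = 0" using has_deg_unique by blast
  with kl show ?thesis by (simp add: has_deg_0_iff)
qed

lemma kernel_power_factor: "D (a ^ n) = 0 \<Longrightarrow> n > 0 \<Longrightarrow> D a = 0"
  using kernel_factor[of a "a ^ (n - 1)"] D_0 by (cases "a = 0"; cases n) auto

end

section \<open>Forms with locally nilpotent Poisson bracket\<close>

abbreviation const2 :: "'k::zero \<Rightarrow> 'k poly poly" where "const2 c \<equiv> [:[:c:]:]"

lemma dX_1 [simp]: "dX 1 = 0"
  by (simp add: one_pCons dX_pCons)

lemma dY_mult: "dY (f * g) = dY f * g + f * dY g"
  by (simp add: pderiv_mult algebra_simps)

lemma dX_varX: "dX varX = 1" and dX_varY: "dX varY = 0"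
  by (simp_all add: dX_pCons pderiv_pCons one_pCons)

lemma dY_const: "dY (const2 c) = 0" and const2_1: "const2 1 = (1 :: 'k::comm_semiring_1 poly poly)"
  by (simp_all flip: one_pCons)

lemma dX_const_mult: "dX (const2 c * f) = const2 c * dX f"
  by (simp add: dX_smult)

lemma bimonom_eq: "bimonom c i j = const2 c * (varX ^ i * varY ^ j)" for c :: "'k::comm_ring_1"
proof -
  have X: "bimonom 1 1 0 ^ i = (bimonom 1 i 0 :: 'k poly poly)"
    by (induction i) (simp_all add: bimonom_mult, simp add: bimonom_def one_pCons monom_0)
  have Y: "bimonom 1 0 1 ^ j = (bimonom 1 0 j :: 'k poly poly)"
    by (induction j) (simp_all add: bimonom_mult, simp add: bimonom_def one_pCons monom_0)
  have "const2 c = bimonom c 0 0" by (simp add: bimonom_def monom_0)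
  then show ?thesis unfolding varX_eq varY_eq X Y by (simp add: bimonom_mult del: mult_pCons_left)
qed

lemma poisson_simps: 
  "poisson f 0 = 0" "poisson f (- g) = - poisson f g" "poisson f (const2 c) = 0"
  "poisson f varX = dY f" "poisson f varY = - dX f"
  by (simp_all add: poisson_def dX_pCons dX_minus pderiv_minus pderiv_pCons flip: one_pCons)

text \<open>The elements annihilated by some power of a derivation form a subring; here it contains
  the scalars and both variables.\<close>

lemma poisson_nilpotentI:
  assumes "\<exists>k. (poisson f ^^ k) varX = 0" "\<exists>k. (poisson f ^^ k) varY = 0"
  shows "\<exists>k. (poisson f ^^ k) g = 0"
proof -
  note derivation = poisson_add_right poisson_mult_right
  have plus: "\<exists>k. (poisson f ^^ k) (g + h) = 0"
    if g: "(poisson f ^^ k) g = 0" and h: "(poisson f ^^ l) h = 0" for g h k l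
  proof -
    have "(poisson f ^^ max k l) g = 0"
      by (rule derivation_funpow_eq_0_mono[of "poisson f", OF derivation g]) simp
    moreover have "(poisson f ^^ max k l) h = 0"
      by (rule derivation_funpow_eq_0_mono[of "poisson f", OF derivation h]) simp
    ultimately have "(poisson f ^^ max k l) (g + h) = 0"
      by (simp add: derivation_funpow_add[of "poisson f", OF derivation])
    then show ?thesis by blast
  qed
  have times: "\<exists>k. (poisson f ^^ k) (g * h) = 0"
    if "\<exists>k. (poisson f ^^ k) g = 0" "\<exists>k. (poisson f ^^ k) h = 0" for g h
  proof -
    from that obtain k l where "(poisson f ^^ k) g = 0" "(poisson f ^^ l) h = 0" by blast
    then show ?thesis by (rule derivation_nilpotent_mult[of "poisson f", OF derivation])
  qed
  have const: "\<exists>k. (poisson f ^^ k) (const2 c) = 0" for c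
    by (rule exI[of _ 1]) (simp add: poisson_simps)
  have powers: "\<exists>k. (poisson f ^^ k) (h ^ n) = 0" if "\<exists>k. (poisson f ^^ k) h = 0" for h n
  proof (induction n)
    case 0
    show ?case using const[of 1] by (simp add: one_pCons)
  qed (use times that in simp)
  show ?thesis
  proof (induction g rule: poly2_induct)
    case zero
    show ?case by (rule exI[of _ 0]) simp
  next
    case (monom i j)
    show ?case unfolding bimonom_eq by (intro times const powers assms)
  next
    case (add g h)
    with plus show ?case by blast
  qed
qed

text \<open>The binary form V^n u(U/V). Coefficients of \<open>u\<close> beyond \<open>n\<close> are
  dropped, hence the degree bound in the factorization lemma.\<close>

definition homogenize :: "'k::field_char_0 poly poly \<Rightarrow> 'k poly poly \<Rightarrow> nat \<Rightarrow> 'k poly \<Rightarrow> 'k poly poly"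
  where "homogenize U V n u = (\<Sum>k\<le>n. const2 (coeff u k) * U ^ k * V ^ (n - k))"

lemma homogenize_smult: "homogenize U V n (smult c u) = const2 c * homogenize U V n u"
  unfolding homogenize_def sum_distrib_left by (intro sum.cong refl) simp

lemma homogenize_linear_mult:
  assumes "degree u \<le> n"
  shows "homogenize U V (Suc n) ([:- x, 1:] * u) = (U - const2 x * V) * homogenize U V n u"
proof -
  have V: "homogenize U V (Suc n) u = V * homogenize U V n u"
    unfolding homogenize_def sum.atMost_Suc sum_distrib_left
    using assms by (auto intro!: sum.cong simp: Suc_diff_le coeff_eq_0 mult.left_commute)
  have "homogenize U V (Suc n) ([:- x, 1:] * u) =
      homogenize U V (Suc n) (pCons 0 u) - homogenize U V (Suc n) (smult x u)"
    unfolding homogenize_def sum_subtractf[symmetric]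
    by (intro sum.cong refl) (simp add: algebra_simps flip: left_diff_distrib smult_diff_left)
  also have "homogenize U V (Suc n) (pCons 0 u) = U * homogenize U V n u"
    unfolding homogenize_def sum.atMost_Suc_shift sum_distrib_left
    by (simp add: mult.assoc)
  also have "homogenize U V (Suc n) (smult x u) = const2 x * (V * homogenize U V n u)"
    by (simp only: homogenize_smult V)
  finally show ?thesis by (simp add: algebra_simps)
qed

lemma homogenize_linear_power:
  "homogenize U V n ([:- x, 1:] ^ n) = (U - const2 x * V) ^ n"
proof (induction n)
  case 0
  show ?case by (simp add: homogenize_def one_pCons)
next
  case (Suc n)
  then show ?case
    unfolding power_Suc by (subst homogenize_linear_mult) (simp_all add: degree_power_eq)
qed

text \<open>
  Factors of \<open>f\<close> lie in the kernel of \<open>poisson f\<close>.  Two non-proportional factors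
  \<open>Y\<^sup>r - x X\<^sup>s\<close> would put \<open>X\<^sup>s\<close>, hence \<open>X\<close>, into it.  If \<open>r, s \<ge> 2\<close>, the nilpotency degrees \<open>k\<close> of \<open>X\<close> and \<open>l\<close> of \<open>Y\<close>
  would satisfy \<open>k - 1 = (r - 1) l\<close> and \<open>l - 1 = (s - 1) k\<close>.
\<close>

lemma homogeneous_locally_nilpotent:
  fixes c :: "nat \<Rightarrow> 'k::{alg_closed_field, field_char_0}"
  assumes f: "f = (\<Sum>k\<le>d div r. bimonom (c k) (s * k) (d - r * k))"
    and pos: "r > 0" "s > 0" "d > 0" and c0: "c 0 \<noteq> 0"
    and nil: "\<And>g. \<exists>k. (poisson f ^^ k) g = 0"
  shows "f = bimonom (c 0) 0 d \<or>
    (\<exists>x. x \<noteq> 0 \<and> r dvd d \<and> (r = 1 \<or> s = 1) \<and>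
      f = const2 (c 0) * (varY ^ r - const2 x * varX ^ s) ^ (d div r))"
proof -
  interpret D: locally_nilpotent_derivation "poisson f"
    by unfold_locales (use nil in \<open>auto simp: poisson_add_right poisson_mult_right\<close>)
  define M where "M = d div r"
  have le: "r * k \<le> d" if "k \<le> M" for k
    using that pos unfolding M_def by (metis div_times_less_eq_dividend le_trans mult.commute mult_le_mono2)
  have cf_f: "cf f (s * k) (d - r * k) = c k" if "k \<le> M" for k
  proof -
    have "cf f (s * k) (d - r * k) = (\<Sum>l\<le>M. if l = k then c k else 0)"
      unfolding f M_def[symmetric] cf_def coeff_sum
      unfolding cf_def[symmetric] cf_bimonom using pos by (intro sum.cong) auto
    then show ?thesis using that by simp
  qed
  have f0: "f \<noteq> 0" using cf_f[of 0] c0 by auto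
  \<comment> \<open>The bracket with X is \<open>dY f\<close>, whose coefficient at Y^(d-1) is d
    times \<open>c 0\<close>.\<close>
  have DX: "poisson f varX \<noteq> 0"
  proof
    assume "poisson f varX = 0"
    then have "cf (dY f) 0 (d - 1) = 0" by (simp add: poisson_simps)
    then show False using cf_f[of 0] c0 pos by (simp add: cf_dY)
  qed
  show ?thesis
  proof (cases "poisson f varY = 0")
    case True
    have "c k = 0" if "k \<le> M" "k \<noteq> 0" for k
    proof -
      have "cf (dX f) (s * k - 1) (d - r * k) = 0" using True by (simp add: poisson_simps)
      then show ?thesis
        using that pos cf_f[of k] by (simp add: cf_dX flip: of_nat_Suc)
    qed
    then have "f = (\<Sum>k\<le>M. if k = 0 then bimonom (c 0) 0 d else 0)"
      unfolding f M_def[symmetric] by (intro sum.cong) auto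
    then show ?thesis by simp
  next
    case DY: False
    define U V :: "'k poly poly" where "U = varY ^ r" and "V = varX ^ s"
    \<comment> \<open>The coefficients are reversed: the nonzero \<open>c 0\<close> becomes the
      leading one, so \<open>u\<close> has degree exactly \<open>M\<close>, and up to a power of Y
      the form \<open>f\<close> is the homogenization of \<open>u\<close>.\<close>
    define u where "u = (\<Sum>k\<le>M. monom (c (M - k)) k)"
    have coeff_u: "coeff u k = (if k \<le> M then c (M - k) else 0)" for k
      by (simp add: u_def coeff_sum)
    have deg_u: "degree u = M"
      by (rule antisym[OF degree_le le_degree]) (use c0 in \<open>auto simp: coeff_u\<close>)
    have "f = (\<Sum>k\<le>M. bimonom (c (M - k)) (s * (M - k)) (d - r * (M - k)))"
      unfolding f M_def[symmetric] by (rule sum.nat_diff_reindex[symmetric, of _ "Suc M", simplified lessThan_Suc_atMost diff_Suc_Suc, simplified])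
    also have "\<dots> = varY ^ (d - r * M) * homogenize U V M u"
      unfolding homogenize_def sum_distrib_left
    proof (intro sum.cong refl)
      fix k assume "k \<in> {..M}"
      then have "d - r * (M - k) = (d - r * M) + r * k"
        using le[of M] by (simp add: right_diff_distrib')
      with \<open>k \<in> {..M}\<close> show "bimonom (c (M - k)) (s * (M - k)) (d - r * (M - k)) =
          varY ^ (d - r * M) * (const2 (coeff u k) * U ^ k * V ^ (M - k))"
        unfolding bimonom_eq
        by (simp only: coeff_u U_def V_def power_mult power_add atMost_iff if_True)
          (simp only: mult_ac)
    qed
    finally have f_eq: "f = varY ^ (d - r * M) * homogenize U V M u" .
    \<comment> \<open>A positive leftover power of Y would be a factor of \<open>f\<close> and would
      put Y into the kernel.\<close>
    have dM: "d = r * M"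
    proof (rule ccontr)
      assume "d \<noteq> r * M"
      with le[of M] have "d - r * M > 0" by simp
      moreover have "poisson f (varY ^ (d - r * M)) = 0"
        using D.kernel_factor[of "varY ^ (d - r * M)" "homogenize U V M u"] f_eq f0
        by (metis poisson_self)
      ultimately show False using D.kernel_power_factor DY by blast
    qed
    with f_eq have f_eq: "f = homogenize U V M u" by simp
    have root: "poisson f (U - const2 x * V) = 0" if "poly u x = 0" for x
    proof -
      from that obtain v where v: "u = [:- x, 1:] * v" by (metis dvdE poly_eq_0_iff_dvd)
      have "v \<noteq> 0" using v deg_u dM pos by auto
      then have "degree u = Suc (degree v)" unfolding v by (subst degree_mult_eq) auto
      then obtain m where "M = Suc m" "degree v \<le> m" using deg_u by auto
      with f_eq v have "f = (U - const2 x * V) * homogenize U V m v"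
        by (simp add: homogenize_linear_mult del: mult_pCons_left)
      with D.kernel_factor f0 show ?thesis by (metis poisson_self)
    qed
    obtain A where A: "size A = degree u" "u = smult (lead_coeff u) (\<Prod>x\<in>#A. [:- x, 1:])"
      using alg_closed_imp_factorization[of u] c0 coeff_u[of M] by force
    have A_root: "poly u x = 0" if "x \<in># A" for x
      using that by (subst A(2)) (auto simp: poly_prod_mset)
    have "M > 0" using dM pos by (cases M) auto
    with A(1) deg_u obtain x where x: "x \<in># A" by (metis multiset_nonemptyE not_gr_zero size_empty)
    have "y = x" if "y \<in># A" for y
    proof (rule ccontr)
      assume "y \<noteq> x"
      have "poisson f ((U - const2 x * V) - (U - const2 y * V)) = 0"
        by (simp only: D.diff[of "U - const2 x * V"] root[OF A_root[OF x]] root[OF A_root[OF that]]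
            diff_0_right)
      also have "(U - const2 x * V) - (U - const2 y * V) = varX ^ s * const2 (y - x)"
        unfolding V_def by (simp add: algebra_simps flip: smult_add_left)
      finally have "poisson f (varX ^ s) = 0"
        using D.kernel_factor[of "varX ^ s" "const2 (y - x)"] \<open>y \<noteq> x\<close> by auto
      with D.kernel_power_factor pos DX show False by blast
    qed
    then have "A = replicate_mset M x"
      using A(1) deg_u by (metis set_mset_subset_singletonD singletonI subsetI)
    with A(2) deg_u coeff_u[of M] have "u = smult (c 0) ([:- x, 1:] ^ M)" by simp
    with f_eq have f_eq: "f = const2 (c 0) * (U - const2 x * V) ^ M"
      by (simp only: homogenize_smult homogenize_linear_power)
    have "x \<noteq> 0"
    proof
      assume "x = 0"
      with f_eq dM have "f = varY ^ d * const2 (c 0)"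
        by (simp add: U_def flip: power_mult)
      then have "poisson f (varY ^ d) = 0" using D.kernel_factor f0 by (metis poisson_self)
      with D.kernel_power_factor pos DY show False by blast
    qed
    moreover have "r = 1 \<or> s = 1"
    proof (rule ccontr)
      assume "\<not> (r = 1 \<or> s = 1)"
      then have rs: "r \<ge> 2" "s \<ge> 2" using pos by auto
      define g where "g = (U - const2 x * V)"
      \<comment> \<open>By the chain rule the partial derivatives of \<open>f\<close> are
        \<open>h\<close> times those of \<open>g\<close>. Being built from scalars and powers of
        \<open>g\<close>, \<open>h\<close> has degree 0, so the degrees of these derivatives can be
        read off.\<close>
      define h where "h = const2 (c 0) * of_nat M * g ^ (M - 1)"
      have Dg: "poisson f g = 0" using root[OF A_root[OF x]] by (simp add: g_def)
      have g0: "g \<noteq> 0" using f_eq f0 \<open>M > 0\<close> by (auto simp: g_def)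
      have h: "D.has_deg 0 (h * of_nat m * const2 y)" if "m > 0" "y \<noteq> 0" for m y
      proof -
        have n: "D.has_deg 0 (of_nat n)" if "n > 0" for n
          using that by (simp add: D.has_deg_0_iff derivation_of_nat[of "poisson f", OF D.add D.mult])
        have c: "D.has_deg 0 (const2 y)" if "y \<noteq> 0" for y
          using that by (simp add: D.has_deg_0_iff poisson_simps)
        have "D.has_deg 0 (g ^ (M - 1))"
          using D.has_deg_power[of 0 g "M - 1"] Dg g0 by (simp add: D.has_deg_0_iff)
        with n[OF \<open>M > 0\<close>] n[OF that(1)] c[OF c0] c[OF that(2)] show ?thesis
          unfolding h_def by (metis D.has_deg_mult add_0)
      qed
      note dX_power = derivation_power[of dX, OF dX_add dX_mult]
      note dY_power = derivation_power[of dY, OF pderiv_add dY_mult]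
      have dXg: "dX g = - (const2 x * (of_nat s * varX ^ (s - 1)))"
        unfolding g_def U_def V_def diff_conv_add_uminus
        by (simp only: dX_add dX_minus dX_power dX_const_mult dX_varX dX_varY mult_zero_right
            mult_1_right add_0)
      have dYg: "dY g = of_nat r * varY ^ (r - 1)"
        unfolding g_def U_def V_def diff_conv_add_uminus
        by (simp only: pderiv_add pderiv_minus dY_power dY_mult) (simp add: pderiv_pCons)
      have Y: "poisson f varY = h * of_nat s * const2 x * varX ^ (s - 1)"
        unfolding f_eq g_def[symmetric] poisson_simps dX_const_mult dX_power dXg h_def
        by (simp only: mult_minus_right minus_minus mult_ac)
      have X: "poisson f varX = h * of_nat r * const2 1 * varY ^ (r - 1)"
        unfolding f_eq g_def[symmetric] poisson_simps h_def dY_mult dY_power dYg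
        by (simp only: dY_const const2_1 mult_zero_left mult_1_left mult_1_right add_0 mult_ac)
      obtain k l where kl: "D.has_deg k varX" "D.has_deg l varY"
        using D.has_deg_exists[of varX] D.has_deg_exists[of varY] by auto
      have "k \<noteq> 0" "l \<noteq> 0" using kl DX DY by (metis D.has_deg_0_iff)+
      then obtain k' l' where "k = Suc k'" "l = Suc l'" by (metis not0_implies_Suc)
      have "D.has_deg k' (poisson f varX)" "D.has_deg l' (poisson f varY)"
        using kl \<open>k = Suc k'\<close> \<open>l = Suc l'\<close> D.has_deg_D by auto
      moreover have "D.has_deg (0 + (r - 1) * l) (poisson f varX)"
        unfolding X by (intro D.has_deg_mult h D.has_deg_power kl) (use pos in auto)
      moreover have "D.has_deg (0 + (s - 1) * k) (poisson f varY)"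
        unfolding Y by (intro D.has_deg_mult h D.has_deg_power kl) (use pos \<open>x \<noteq> 0\<close> in auto)
      ultimately have "k' = 0 + (r - 1) * l" "l' = 0 + (s - 1) * k"
        by (blast intro: D.has_deg_unique)+
      \<comment> \<open>Together with the two equations this gives both k > l and l > k.\<close>
      moreover have "1 * l \<le> (r - 1) * l" "1 * k \<le> (s - 1) * k"
        by (rule mult_le_mono1; use rs in linarith)+
      ultimately show False using \<open>k = Suc k'\<close> \<open>l = Suc l'\<close> by linarith
    qed
    moreover have "d div r = M" "r dvd d" using dM pos by auto
    ultimately show ?thesis using f_eq by (auto simp: U_def V_def)
  qed
qed

section \<open>Locally finite elements\<close>

lemma ad_linear: "Vector_Spaces.linear weyl_scale weyl_scale (ad z)"
  by unfold_locales (simp_all add: ad_def algebra_simps weyl.scale_right_diff_distrib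
      weyl_scale_mult_left weyl_scale_mult_right)

interpretation ad: Vector_Spaces.linear weyl_scale weyl_scale "ad z" for z
  by (rule ad_linear)

definition ad_orbit :: "'k::field weyl \<Rightarrow> 'k weyl \<Rightarrow> nat \<Rightarrow> 'k weyl set"
  where "ad_orbit z x n = (\<lambda>i. (ad z ^^ i) x) ` {..<n}"

lemma ad_orbit_0 [simp]: "ad_orbit z x 0 = {}"
  and ad_orbit_Suc: "ad_orbit z x (Suc n) = insert ((ad z ^^ n) x) (ad_orbit z x n)"
  by (simp_all add: ad_orbit_def lessThan_Suc)

lemma finite_ad_orbit: "finite (ad_orbit z x n)"
  by (simp add: ad_orbit_def)

text \<open>Finite dimension of K[ad z](x) is expressed by one linear relation: some iterate depends
  on the preceding ones. In this form it can be pulled back along an injective homomorphism.\<close>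

definition locally_finite :: "'k::field weyl \<Rightarrow> bool"
  where "locally_finite z \<longleftrightarrow> (\<forall>x. \<exists>n. (ad z ^^ n) x \<in> weyl.span (ad_orbit z x n))"

text \<open>Once an iterate depends on its predecessors, their span is stable under
  \<open>ad z\<close> and contains the whole orbit.\<close>

lemma locally_finite_span:
  assumes "locally_finite z"
  shows "\<exists>n. \<forall>k. (ad z ^^ k) x \<in> weyl.span (ad_orbit z x n)"
proof -
  from assms obtain n where n: "(ad z ^^ n) x \<in> weyl.span (ad_orbit z x n)"
    unfolding locally_finite_def by blast
  have step: "ad z y \<in> weyl.span (ad_orbit z x n)" if "y \<in> weyl.span (ad_orbit z x n)" for y
  proof -
    have "ad z ` ad_orbit z x n \<subseteq> weyl.span (ad_orbit z x n)"
    proof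
      fix w assume "w \<in> ad z ` ad_orbit z x n"
      then obtain i where i: "i < n" "w = (ad z ^^ Suc i) x" by (auto simp: ad_orbit_def)
      show "w \<in> weyl.span (ad_orbit z x n)"
      proof (cases "Suc i = n")
        case True
        with n i show ?thesis by simp
      next
        case False
        with i have "w \<in> ad_orbit z x n" unfolding ad_orbit_def by (intro image_eqI[of _ _ "Suc i"]) auto
        then show ?thesis by (rule weyl.span_base)
      qed
    qed
    then have "weyl.span (ad z ` ad_orbit z x n) \<subseteq> weyl.span (ad_orbit z x n)"
      by (metis weyl.span_mono weyl.span_span)
    with that show ?thesis unfolding ad.span_image by blast
  qed
  have "(ad z ^^ k) x \<in> weyl.span (ad_orbit z x n)" for k
  proof (induction k)
    case 0
    show ?case using n by (cases n) (auto simp: ad_orbit_def intro!: weyl.span_base image_eqI[of _ _ 0])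
  qed (simp add: step)
  then show ?thesis by blast
qed

text \<open>If no iterate depended on the earlier ones, initial pieces of the orbit would be
  independent sets of every size inside the span of a finite set. The monomials among the
  polynomials in \<open>ad z\<close> place the iterates in that span.\<close>

lemma locally_finite_if_F:
  assumes "weyl_F z = UNIV"
  shows "locally_finite z"
  unfolding locally_finite_def
proof (rule allI, rule ccontr)
  fix x assume "\<nexists>n. (ad z ^^ n) x \<in> weyl.span (ad_orbit z x n)"
  then have new: "(ad z ^^ n) x \<notin> weyl.span (ad_orbit z x n)" for n by blast
  from assms have "x \<in> weyl_F z" by simp
  then obtain B where B: "finite B" "weyl.span B = range (\<lambda>f. poly_ad f z x)"
    unfolding weyl_F_def by blast
  have in_span: "ad_orbit z x n \<subseteq> weyl.span B" for n
  proof
    fix y assume "y \<in> ad_orbit z x n"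
    then obtain i where "y = (ad z ^^ i) x" by (auto simp: ad_orbit_def)
    also have "\<dots> = poly_ad (monom 1 i) z x"
    proof -
      have "poly_ad (monom 1 i) z x = (\<Sum>k\<le>i. weyl_scale (if i = k then 1 else 0) ((ad z ^^ k) x))"
        by (simp add: poly_ad_def degree_monom_eq)
      also have "\<dots> = (\<Sum>k\<le>i. if k = i then (ad z ^^ i) x else 0)"
        by (intro sum.cong) auto
      finally show ?thesis by simp
    qed
    finally show "y \<in> weyl.span B" unfolding B(2) by blast
  qed
  have indep: "\<not> weyl.dependent (ad_orbit z x n) \<and> card (ad_orbit z x n) = n" for n
  proof (induction n)
    case (Suc n)
    then show ?case
      using new[of n] weyl.span_base[of "(ad z ^^ n) x" "ad_orbit z x n"]
      by (auto simp: ad_orbit_Suc weyl.independent_insert card_insert_if finite_ad_orbit)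
  qed (simp add: weyl.independent_empty)
  have "card (ad_orbit z x (Suc (card B))) \<le> card B"
    using weyl.independent_span_bound[OF B(1) _ in_span] indep by blast
  with indep show False by (metis not_less_eq_eq order_refl)
qed

lemma locally_finite_if_N:
  assumes "weyl_N z = UNIV"
  shows "locally_finite z"
proof -
  have "\<exists>n. (ad z ^^ n) x = 0" for x using assms by (auto simp: weyl_N_def)
  then show ?thesis unfolding locally_finite_def by (metis weyl.span_zero)
qed

lemma locally_finite_hom_image:
  assumes \<phi>: "weyl_hom \<phi>" and inj: "inj \<phi>" and fin: "locally_finite (\<phi> z)"
  shows "locally_finite z"
  unfolding locally_finite_def
proof
  interpret Vector_Spaces.linear weyl_scale weyl_scale \<phi>
    using \<phi> by (rule weyl_hom_linear)
  fix x
  obtain n where "(ad (\<phi> z) ^^ n) (\<phi> x) \<in> weyl.span (ad_orbit (\<phi> z) (\<phi> x) n)"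
    using fin by (auto simp: locally_finite_def)
  also have "ad_orbit (\<phi> z) (\<phi> x) n = \<phi> ` ad_orbit z x n"
    by (auto simp: ad_orbit_def image_image weyl_hom_ad_funpow[OF \<phi>])
  also have "weyl.span \<dots> = \<phi> ` weyl.span (ad_orbit z x n)"
    by (rule span_image)
  finally have "\<phi> ((ad z ^^ n) x) \<in> \<phi> ` weyl.span (ad_orbit z x n)"
    by (simp add: weyl_hom_ad_funpow[OF \<phi>])
  with inj show "\<exists>n. (ad z ^^ n) x \<in> weyl.span (ad_orbit z x n)"
    by (auto simp: inj_image_mem_iff)
qed

lemma locally_finite_Aut:
  fixes z :: "'k::field weyl"
  assumes "\<alpha> \<in> weyl_Aut" "locally_finite z"
  shows "locally_finite (\<alpha> z)"
proof -
  from assms(1) have \<alpha>: "weyl_hom \<alpha>" "bij \<alpha>" by (auto simp: weyl_Aut_def)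
  then show ?thesis
    using locally_finite_hom_image[OF weyl_hom_inv[OF \<alpha>], of "\<alpha> z"] assms(2)
    by (simp add: bij_imp_bij_inv bij_is_inj)
qed

lemma normal_order_bimonom: "normal_order (bimonom c i j) = weyl_scale c (weyl_p ^ i * weyl_q ^ j)"
proof -
  have *: "weyl_poly (monom c i) weyl_p = weyl_scale c (weyl_p ^ i)" for c :: 'a and i
    by (induction i) (simp_all add: monom_0 monom_Suc weyl_scale_mult_right)
  show ?thesis
    unfolding bimonom_def
    by (induction j)
       (simp_all add: monom_0 monom_Suc * weyl_scale_mult_left mult.assoc power_commutes)
qed

section \<open>The weighted filtration of the Weyl algebra\<close>

context weights
begin

definition filt :: "int \<Rightarrow> 'k::field_char_0 weyl set"
  where "filt n = normal_order ` {f. wle n f}"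

lemma filt_normal_order_iff [simp]: "normal_order f \<in> filt n \<longleftrightarrow> wle n f"
  by (auto simp: filt_def)

lemma filtE:
  assumes "z \<in> filt n"
  obtains f where "wle n f" "z = normal_order f"
  using assms by (auto simp: filt_def)

lemma filt_0 [simp]: "0 \<in> filt n"
  by (metis filt_normal_order_iff normal_order_0 wle_0)

lemma filt_add: "x \<in> filt n \<Longrightarrow> y \<in> filt n \<Longrightarrow> x + y \<in> filt n"
  by (auto elim!: filtE simp: wle_add simp flip: normal_order_add)

lemma filt_diff: "x \<in> filt n \<Longrightarrow> y \<in> filt n \<Longrightarrow> x - y \<in> filt n"
  by (auto elim!: filtE simp: wle_diff simp flip: normal_order_diff)

lemma filt_mono: "x \<in> filt m \<Longrightarrow> m \<le> n \<Longrightarrow> x \<in> filt n"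
  by (auto elim!: filtE intro: wle_mono)

lemma wle_const: "wle 0 (const2 c)"
  using wle_bimonom[of 0 c 0 0] by (simp add: bimonom_def monom_0)

lemma filt_scale: "x \<in> filt n \<Longrightarrow> weyl_scale c x \<in> filt n"
  using wle_mult[OF wle_const[of c]] by (fastforce elim!: filtE simp: normal_order_scale)

lemma filt_mult: "x \<in> filt m \<Longrightarrow> y \<in> filt n \<Longrightarrow> x * y \<in> filt (m + n)"
proof (elim filtE)
  fix f g assume f: "wle m f" "x = normal_order f" and g: "wle n g" "y = normal_order g"
  from normal_order_mult[OF f(1) g(1)] obtain r where r: "wle (m + n - 2 * (\<rho> + \<sigma>)) r"
    "x * y = normal_order (f * g + dY f * dX g + r)" using f g by blast
  have "wle (m + n) (f * g + dY f * dX g + r)"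
    using wle_mult[OF f(1) g(1)] wle_mono[OF wle_mult[OF wle_dY[OF f(1)] wle_dX[OF g(1)]]]
      wle_mono[OF r(1)] pos by (intro wle_add) auto
  with r show ?thesis by simp
qed

lemma filt_1: "1 \<in> filt 0"
  using filt_normal_order_iff[of "const2 1" 0] by (simp add: wle_const)

lemma filt_power: "x \<in> filt m \<Longrightarrow> x ^ k \<in> filt (int k * m)"
  by (induction k) (auto simp: filt_1 distrib_right intro: filt_mult)

text \<open>It is enough to control the images of the generators, because normally ordered monomials
  of weight at most \<open>n\<close> span the filtration step. This is how shears are seen not to
  raise weights.\<close>

lemma filt_hom:
  assumes \<phi>: "weyl_hom \<phi>" and p: "\<phi> weyl_p \<in> filt \<rho>" and q: "\<phi> weyl_q \<in> filt \<sigma>"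
    and "z \<in> filt n"
  shows "\<phi> z \<in> filt n"
proof -
  from assms(4) obtain f where f: "wle n f" "z = normal_order f" by (rule filtE)
  have "\<phi> (normal_order f) \<in> filt n"
  proof (induction f rule: poly2_induct)
    case zero
    show ?case by (simp add: weyl_hom_simps[OF \<phi>])
  next
    case (monom i j)
    have "\<phi> weyl_p ^ i * \<phi> weyl_q ^ j \<in> filt (int i * \<rho> + int j * \<sigma>)"
      by (intro filt_mult filt_power p q)
    moreover have "int i * \<rho> + int j * \<sigma> \<le> n"
      using wleD[OF f(1) monom] by (simp add: mult.commute)
    ultimately show ?case
      by (auto simp: normal_order_bimonom weyl_hom_simps[OF \<phi>] weyl_hom_power[OF \<phi>]
          intro: filt_scale filt_mono)
  next
    case (add g h)
    then show ?case by (simp add: normal_order_add weyl_hom_simps[OF \<phi>] filt_add)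
  qed
  with f show ?thesis by simp
qed

text \<open>Passing to symbols is multiplicative up to contractions, each of which lowers the weight
  by at least 1.\<close>

lemma normal_order_power:
  assumes "wle n f"
  shows "normal_order (f ^ k) - normal_order f ^ k \<in> filt (int k * n - 1)"
proof (induction k)
  case 0
  have "normal_order 1 = (1 :: 'a weyl)" by (simp add: one_pCons)
  then show ?case by simp
next
  case (Suc k)
  have fk: "wle (int k * n) (f ^ k)"
  proof (induction k)
    case 0
    show ?case using wle_const[of 1] by (simp add: one_pCons)
  next
    case (Suc k)
    with wle_mult[OF assms Suc] show ?case by (simp add: algebra_simps)
  qed
  obtain r where r: "wle (n + int k * n - 2 * (\<rho> + \<sigma>)) r"
    "normal_order f * normal_order (f ^ k) = normal_order (f * f ^ k + dY f * dX (f ^ k) + r)"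
    using normal_order_mult[OF assms fk] by blast
  have "wle (int (Suc k) * n - 1) (dY f * dX (f ^ k) + r)"
    using wle_mono[OF wle_mult[OF wle_dY[OF assms] wle_dX[OF fk]]] wle_mono[OF r(1)] pos
    by (intro wle_add) (auto simp: algebra_simps)
  then have "normal_order (dY f * dX (f ^ k) + r) \<in> filt (int (Suc k) * n - 1)" by simp
  moreover have "normal_order f * (normal_order (f ^ k) - normal_order f ^ k) \<in> filt (int (Suc k) * n - 1)"
    using filt_mult[OF _ Suc, of "normal_order f" n] assms by (simp add: algebra_simps)
  moreover have "normal_order (f ^ Suc k) - normal_order f ^ Suc k =
      normal_order f * (normal_order (f ^ k) - normal_order f ^ k) -
      normal_order (dY f * dX (f ^ k) + r)"
    by (simp add: right_diff_distrib r(2) normal_order_add)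
  ultimately show ?case by (simp only: filt_diff)
qed

lemma subspace_filt: "weyl.subspace (filt n)"
  by (simp add: weyl.subspace_def filt_add filt_scale)

lemma locally_finite_bounded:
  assumes "locally_finite z"
  shows "\<exists>N. \<forall>k. (ad z ^^ k) x \<in> filt N"
proof -
  obtain n where n: "\<And>k. (ad z ^^ k) x \<in> weyl.span (ad_orbit z x n)"
    using locally_finite_span[OF assms] by blast
  have "\<exists>N. ad_orbit z x n \<subseteq> filt N"
  proof (induction n)
    case (Suc n)
    then obtain N where N: "ad_orbit z x n \<subseteq> filt N" by blast
    obtain f where "(ad z ^^ n) x = normal_order f" using normal_order_surj by blast
    then obtain M where "(ad z ^^ n) x \<in> filt M" using exists_wle[of f] by auto
    with N have "ad_orbit z x (Suc n) \<subseteq> filt (max M N)"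
      by (auto simp: ad_orbit_Suc intro: filt_mono)
    then show ?case by blast
  qed simp
  with n weyl.span_minimal[OF _ subspace_filt] show ?thesis by blast
qed

text \<open>On a homogeneous symbol \<open>h\<close> of weight \<open>n\<close>, the part of weight
  n + k w in the k-th iterate of \<open>ad z\<close> is the k-th iterate of the Poisson bracket with
  \<open>f0\<close>, where w = v - (\<rho> + \<sigma>) is positive. Local finiteness bounds the
  weights, so this part vanishes for large k. Both variables are homogeneous, which
  suffices.\<close>

lemma leading_form_locally_nilpotent:
  assumes fin: "locally_finite (normal_order (f0 + f1))"
    and f0: "whom v f0" and f1: "wle (v - 1) f1" and v: "\<rho> + \<sigma> < v"
  shows "\<exists>k. (poisson f0 ^^ k) g = 0"
proof -
  define w where "w = v - (\<rho> + \<sigma>)"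
  define z where "z = normal_order (f0 + f1)"
  have f: "wle v (f0 + f1)"
    using whom_imp_wle[OF f0] wle_mono[OF f1] by (intro wle_add) auto
  have hom: "\<exists>k. (poisson f0 ^^ k) h = 0" if h: "whom n h" for n h
  proof -
    have whom: "whom (n + int k * w) ((poisson f0 ^^ k) h)" for k
    proof (induction k)
      case (Suc k)
      with whom_poisson[OF f0 Suc] show ?case by (simp add: w_def algebra_simps)
    qed (simp add: h)
    have lead: "\<exists>r. wle (n + int k * w - 1) r \<and>
        (ad z ^^ k) (normal_order h) = normal_order ((poisson f0 ^^ k) h + r)" for k
    proof (induction k)
      case 0
      show ?case by (intro exI[of _ 0]) simp
    next
      case (Suc k)
      let ?h = "(poisson f0 ^^ k) h" and ?m = "n + int k * w"
      from Suc obtain r where r: "wle (?m - 1) r"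
        "(ad z ^^ k) (normal_order h) = normal_order (?h + r)" by blast
      have hr: "wle ?m (?h + r)"
        using whom_imp_wle[OF whom] wle_mono[OF r(1)] by (intro wle_add) auto
      obtain s where s: "wle (v + ?m - 2 * (\<rho> + \<sigma>)) s"
        "ad z (normal_order (?h + r)) = normal_order (poisson (f0 + f1) (?h + r) + s)"
        using normal_order_commutator[OF f hr] unfolding z_def by blast
      have "wle (n + int (Suc k) * w - 1) (poisson f1 ?h + poisson (f0 + f1) r + s)"
        using wle_poisson[OF f1 whom_imp_wle[OF whom[of k]]] wle_poisson[OF f r(1)]
          wle_mono[OF s(1)] pos
        by (intro wle_add) (auto simp: w_def algebra_simps)
      moreover have "poisson (f0 + f1) (?h + r) + s =
          (poisson f0 ^^ Suc k) h + (poisson f1 ?h + poisson (f0 + f1) r + s)"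
        by (simp add: poisson_add_left poisson_add_right)
      moreover have "(ad z ^^ Suc k) (normal_order h) = normal_order (poisson (f0 + f1) (?h + r) + s)"
        using r(2) s(2) by simp
      ultimately show ?case by metis
    qed
    obtain N where N: "\<And>k. (ad z ^^ k) (normal_order h) \<in> filt N"
      using locally_finite_bounded[OF fin] unfolding z_def by blast
    \<comment> \<open>As \<open>w\<close> is at least 1, this many steps carry the weight of the
      leading part beyond the bound \<open>N\<close>.\<close>
    define k where "k = nat (N - n + 1)"
    have "N < n + int k * w"
    proof -
      have "1 \<le> w" using v by (simp add: w_def)
      then have "int k * 1 \<le> int k * w" by (intro mult_left_mono) auto
      moreover have "N < n + int k" by (simp add: k_def)
      ultimately show ?thesis by linarith
    qed
    obtain r where r: "wle (n + int k * w - 1) r"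
      "(ad z ^^ k) (normal_order h) = normal_order ((poisson f0 ^^ k) h + r)" using lead by blast
    have "wle N ((poisson f0 ^^ k) h + r)" using N[of k] r(2) by simp
    then have "wle (n + int k * w - 1) ((poisson f0 ^^ k) h + r)"
      using \<open>N < n + int k * w\<close> by (elim wle_mono) simp
    from wle_diff[OF this r(1)] have "wle (n + int k * w - 1) ((poisson f0 ^^ k) h)" by simp
    with whom_wle_eq_0[OF whom] show ?thesis by force
  qed
  show ?thesis
  proof (rule poisson_nilpotentI)
    show "\<exists>k. (poisson f0 ^^ k) varX = 0"
      by (rule hom[of \<rho>]) (unfold varX_eq whom_bimonom, simp)
    show "\<exists>k. (poisson f0 ^^ k) varY = 0"
      by (rule hom[of \<sigma>]) (unfold varY_eq whom_bimonom, simp)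
  qed
qed

end

section \<open>Normal forms of locally finite elements\<close>

definition normal_form :: "'k::field weyl \<Rightarrow> bool"
  where "normal_form z \<longleftrightarrow> (\<exists>u. z = weyl_poly u weyl_q) \<or>
    (\<exists>c d. c \<noteq> 0 \<and> z = weyl_scale c (weyl_p * weyl_q) + weyl_scale d 1)"

definition normalizable :: "'k::field weyl \<Rightarrow> bool"
  where "normalizable z \<longleftrightarrow> (\<exists>\<alpha>\<in>weyl_Aut. normal_form (\<alpha> z))"

lemma normalizableI: "normal_form z \<Longrightarrow> normalizable z"
  unfolding normalizable_def using weyl_Aut_id by (intro bexI[of _ id]) auto

lemma normalizable_Aut:
  assumes "\<alpha> \<in> weyl_Aut" "normalizable (\<alpha> z)"
  shows "normalizable z"
proof -
  from assms(2) obtain \<beta> where "\<beta> \<in> weyl_Aut" "normal_form (\<beta> (\<alpha> z))"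
    by (auto simp: normalizable_def)
  with weyl_Aut_comp[OF this(1) assms(1)] show ?thesis
    unfolding normalizable_def by (intro bexI[of _ "\<beta> \<circ> \<alpha>"]) auto
qed

lemma weyl_poly_pcompose: "weyl_poly (pcompose u v) z = weyl_poly u (weyl_poly v z)"
  by (induction u) (simp_all add: pcompose_pCons weyl_poly_add weyl_poly_mult)

definition shear_q :: "'k::field poly \<Rightarrow> 'k weyl \<Rightarrow> 'k weyl"
  where "shear_q u = weyl_subst weyl_p (weyl_q + weyl_poly u weyl_p)"

definition shear_p :: "'k::field poly \<Rightarrow> 'k weyl \<Rightarrow> 'k weyl"
  where "shear_p u = weyl_subst (weyl_p + weyl_poly u weyl_q) weyl_q"

definition fourier :: "'k::field weyl \<Rightarrow> 'k weyl"
  where "fourier = weyl_subst weyl_q (- weyl_p)"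

lemma elementary_Aut: "shear_q u \<in> weyl_Aut" "shear_p u \<in> weyl_Aut" "fourier \<in> weyl_Aut"
  by (simp_all add: shear_q_def shear_p_def fourier_def shear_q_Aut shear_p_Aut fourier_Aut)

lemma elementary_hom: "weyl_hom (shear_q u)" "weyl_hom (shear_p u)" "weyl_hom fourier"
  using elementary_Aut by (auto simp: weyl_Aut_def)

lemmas elementary_simps = elementary_hom[THEN weyl_hom_simps(1)] elementary_hom[THEN weyl_hom_simps(2)]
  elementary_hom[THEN weyl_hom_simps(3)] elementary_hom[THEN weyl_hom_simps(4)] elementary_hom[THEN weyl_hom_simps(5)]
  elementary_hom[THEN weyl_hom_simps(6)] elementary_hom[THEN weyl_hom_simps(7)] elementary_hom[THEN weyl_hom_power]
  elementary_hom[THEN weyl_hom_poly]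

lemma elementary_generators [simp]:
  "shear_q u weyl_p = weyl_p" "shear_q u weyl_q = weyl_q + weyl_poly u weyl_p"
  "shear_p u weyl_p = weyl_p + weyl_poly u weyl_q" "shear_p u weyl_q = weyl_q"
  "fourier weyl_p = weyl_q" "fourier weyl_q = - weyl_p"
  by (simp_all add: shear_q_def shear_p_def fourier_def weyl_subst_p[OF fourier_relation]
      weyl_subst_q[OF fourier_relation] weyl_subst_p[OF shear_q_relation] weyl_subst_q[OF shear_q_relation]
      weyl_subst_p[OF shear_p_relation] weyl_subst_q[OF shear_p_relation])

text \<open>If c = 0 and a is nonzero, the shear p -> p - h(q)/a leaves a p, which the Fourier
  automorphism turns into a q. If c is nonzero, the translation q -> q - a/c absorbs a p; writing
  the new polynomial as d + q k(q), the shear p -> p - k(q)/c removes all of it except the constant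
  d.\<close>

lemma normalizable_linear:
  "normalizable (weyl_scale a weyl_p + weyl_scale c (weyl_p * weyl_q) + weyl_poly h weyl_q)"
proof -
  have lin: "normalizable (weyl_scale a weyl_p + weyl_poly h weyl_q)" for h
  proof (cases "a = 0")
    case True
    then show ?thesis by (auto intro!: normalizableI simp: normal_form_def)
  next
    case False
    let ?u = "smult (- inverse a) h"
    have "fourier (shear_p ?u (weyl_scale a weyl_p + weyl_poly h weyl_q)) = weyl_poly [:0, a:] weyl_q"
      using False by (simp add: elementary_simps weyl.scale_right_distrib weyl_poly_smult weyl_poly_minus
          weyl_scale_mult_right weyl.scale_right_diff_distrib)
    then have "normal_form (fourier (shear_p ?u (weyl_scale a weyl_p + weyl_poly h weyl_q)))"
      unfolding normal_form_def by metis
    then show ?thesis by (blast intro: normalizableI normalizable_Aut elementary_Aut)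
  qed
  show ?thesis
  proof (cases "c = 0")
    case True
    with lin show ?thesis by simp
  next
    case False
    let ?v = "[:- (a / c):]"
    define h' where "h' = pcompose h [:- (a / c), 1:]"
    obtain d k where dk: "h' = pCons d k" by (cases h')
    let ?u = "smult (- inverse c) k"
    have "shear_q ?v (weyl_scale a weyl_p + weyl_scale c (weyl_p * weyl_q) + weyl_poly h weyl_q) =
        weyl_scale c (weyl_p * weyl_q) + weyl_poly h' weyl_q"
      using False
      by (simp add: elementary_simps h'_def weyl_poly_pcompose weyl.scale_right_distrib
          weyl_scale_mult_right distrib_left weyl_scale_mult_left add.commute right_diff_distrib
          weyl.scale_right_diff_distrib)
    moreover have "shear_p ?u (weyl_scale c (weyl_p * weyl_q) + weyl_poly h' weyl_q) =
        weyl_scale c (weyl_p * weyl_q) + weyl_scale d 1"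
      using False
      by (simp add: elementary_simps dk distrib_right weyl.scale_right_distrib weyl_poly_smult weyl_poly_minus
          weyl_scale_mult_left weyl_poly_commute left_diff_distrib weyl.scale_right_diff_distrib)
    ultimately have "normal_form (shear_p ?u (shear_q ?v
        (weyl_scale a weyl_p + weyl_scale c (weyl_p * weyl_q) + weyl_poly h weyl_q)))"
      using False unfolding normal_form_def by metis
    then show ?thesis by (blast intro: normalizableI normalizable_Aut elementary_Aut)
  qed
qed

definition inY :: "'k::field_char_0 poly \<Rightarrow> 'k poly poly"
  where "inY h = map_poly (\<lambda>c. [:c:]) h"

lemma cf_inY: "cf (inY h) i j = (if i = 0 then coeff h j else 0)"
  by (simp add: cf_def inY_def coeff_map_poly coeff_pCons split: nat.split)

lemma normal_order_inY: "normal_order (inY h) = weyl_poly h weyl_q"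
  by (induction h) (simp_all add: inY_def map_poly_pCons weyl_poly_commute)

definition partY :: "'k::field_char_0 poly poly \<Rightarrow> 'k poly"
  where "partY f = map_poly (\<lambda>u. coeff u 0) f"

lemma coeff_partY: "coeff (partY f) j = cf f 0 j"
  by (simp add: partY_def cf_def coeff_map_poly)

lemma normalizable_if_support:
  assumes "\<And>i j. cf f i j \<noteq> 0 \<Longrightarrow> i > 0 \<Longrightarrow> i = 1 \<and> j \<le> 1"
  shows "normalizable (normal_order f)"
proof -
  have "f = bimonom (cf f 1 0) 1 0 + bimonom (cf f 1 1) 1 1 + inY (partY f)"
  proof (rule cf_eqI)
    fix i j
    show "cf f i j = cf (bimonom (cf f 1 0) 1 0 + bimonom (cf f 1 1) 1 1 + inY (partY f)) i j"
      using assms[of i j]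
      by (cases "i = 0"; cases "cf f i j = 0"; cases j)
         (auto simp: cf_add cf_bimonom cf_inY coeff_partY)
  qed
  then have "normal_order f = weyl_scale (cf f 1 0) weyl_p + weyl_scale (cf f 1 1) (weyl_p * weyl_q)
      + weyl_poly (partY f) weyl_q"
    by (metis (no_types, lifting) mult.right_neutral normal_order_add normal_order_bimonom
        normal_order_inY power_0 power_one_right)
  with normalizable_linear show ?thesis by simp
qed

interpretation total: weights 1 1
  by unfold_locales simp

text \<open>It suffices to remove p^2. Without p q and q^2 the Fourier automorphism does so.
  Otherwise the shear q -> q + x p changes the coefficient of p^2 to a + b x + c x^2, and x is
  chosen as a root.\<close>

lemma normalizable_quadratic:
  fixes f :: "'k::{alg_closed_field, field_char_0} poly poly"
  assumes "total.wle 2 f"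
  shows "normalizable (normal_order f)"
proof -
  define a b c e h0 h1 where "a = cf f 2 0" and "b = cf f 1 1" and "c = cf f 0 2"
    and "e = cf f 1 0" and "h0 = cf f 0 0" and "h1 = cf f 0 1"
  note defs = this
  have "f = bimonom a 2 0 + bimonom b 1 1 + bimonom c 0 2 + bimonom e 1 0 + bimonom h1 0 1 + bimonom h0 0 0"
  proof (rule cf_eqI)
    fix i j
    show "cf f i j = cf (bimonom a 2 0 + bimonom b 1 1 + bimonom c 0 2 + bimonom e 1 0 + bimonom h1 0 1
        + bimonom h0 0 0) i j"
    proof (cases "i + j \<le> 2")
      case True
      then consider "i = 0" "j = 0" | "i = 0" "j = 1" | "i = 0" "j = 2" | "i = 1" "j = 0" | "i = 1" "j = 1"
        | "i = 2" "j = 0" by linarith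
      then show ?thesis by cases (simp_all add: cf_add cf_bimonom defs)
    next
      case False
      with total.wleD[OF assms, of i j] have "cf f i j = 0" by force
      with False show ?thesis by (auto simp: cf_add cf_bimonom)
    qed
  qed
  then have z: "normal_order f = weyl_scale a (weyl_p * weyl_p) + weyl_scale b (weyl_p * weyl_q)
      + weyl_scale c (weyl_q * weyl_q) + weyl_scale e weyl_p + weyl_scale h1 weyl_q + weyl_scale h0 1"
    by (metis (no_types, lifting) mult.right_neutral mult_1 normal_order_add normal_order_bimonom
         power_0 power_one_right power2_eq_square)
  show ?thesis
  proof (cases "b = 0 \<and> c = 0")
    case True
    have *: "fourier (normal_order f) =
        weyl_scale (- h1) weyl_p + weyl_scale 0 (weyl_p * weyl_q) + weyl_poly [:h0, e, a:] weyl_q"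
      using True by (simp add: z elementary_simps weyl_scale_mult_right distrib_left)
    have "normalizable (fourier (normal_order f))" unfolding * by (rule normalizable_linear)
    then show ?thesis by (rule normalizable_Aut[OF elementary_Aut(3)])
  next
    case False
    have "degree [:a, b, c:] > 0" using False by simp
    then obtain x where x: "poly [:a, b, c:] x = 0" by (metis alg_closed_imp_poly_has_root)
    then have a: "a = - (b * x + c * (x * x))" by (simp add: algebra_simps eq_neg_iff_add_eq_0)
    have two: "weyl_scale (c * (x * 2)) w = weyl_scale (c * x) w + weyl_scale (c * x) w" for w :: "'k weyl"
      by (simp add: algebra_simps flip: weyl.scale_left_distrib)
    \<comment> \<open>The constant \<open>c * x\<close> arises from reordering q p in (q + x
      p)^2.\<close>
    have *: "shear_q [:0, x:] (normal_order f) = weyl_scale (e + h1 * x) weyl_p +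
        weyl_scale (b + (x * c + x * c)) (weyl_p * weyl_q) + weyl_poly [:h0 + c * x, h1, c:] weyl_q"
      unfolding z a
      by (simp add: elementary_simps weyl_scale_mult_right weyl_scale_mult_left distrib_left distrib_right
          weyl.scale_right_distrib weyl.scale_left_distrib weyl_relation' two algebra_simps)
    have "normalizable (shear_q [:0, x:] (normal_order f))" unfolding * by (rule normalizable_linear)
    then show ?thesis by (rule normalizable_Aut[OF elementary_Aut(1)])
  qed
qed

section \<open>Edges of the Newton polygon\<close>

lemma (in weights) cf_whom_add_wle:
  assumes "wle (n - 1) g" "\<rho> * int i + \<sigma> * int j = n"
  shows "cf (f + g) i j = cf f i j"
  using wleD[OF assms(1), of i j] assms(2) by (force simp: cf_add)

text \<open>On the line r i + s j = s d coprimality makes s divide i; with i = s k this gives j = d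
  - r k.\<close>

lemma weights_line_form:
  assumes rs: "coprime r s" "r > 0" "s > 0"
    and f: "weights.whom (int r) (int s) (int (s * d)) f"
  shows "f = (\<Sum>k\<le>d div r. bimonom (cf f (s * k) (d - r * k)) (s * k) (d - r * k))"
proof (rule cf_eqI)
  interpret weights "int r" "int s" by unfold_locales (use rs in simp)
  fix i j
  let ?t = "\<lambda>k. cf (bimonom (cf f (s * k) (d - r * k)) (s * k) (d - r * k)) i j"
  have sum: "cf (\<Sum>k\<le>d div r. bimonom (cf f (s * k) (d - r * k)) (s * k) (d - r * k)) i j = (\<Sum>k\<le>d div r. ?t k)"
    by (simp add: cf_def coeff_sum)
  show "cf f i j = cf (\<Sum>k\<le>d div r. bimonom (cf f (s * k) (d - r * k)) (s * k) (d - r * k)) i j"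
  proof (cases "cf f i j = 0")
    case True
    have "?t k = 0" for k using True by (auto simp: cf_bimonom)
    with sum True show ?thesis by simp
  next
    case False
    from whomD[OF f False] have eq: "r * i + s * j = s * d"
      by (metis of_nat_add of_nat_eq_iff of_nat_mult)
    then have "s dvd r * i" by (metis dvd_add_left_iff dvd_triv_left)
    with rs obtain k where k: "i = s * k"
      by (metis coprime_commute coprime_dvd_mult_right_iff dvdE)
    with eq have "s * (r * k + j) = s * d" by (simp add: algebra_simps)
    then have d: "r * k + j = d" using rs by simp
    then have kM: "k \<le> d div r" using rs by (auto simp: less_eq_div_iff_mult_less_eq mult.commute)
    have "(\<Sum>l\<le>d div r. ?t l) = (\<Sum>l\<le>d div r. if l = k then cf f i j else 0)"
      using k d rs by (intro sum.cong) (auto simp: cf_bimonom)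
    with sum kM show ?thesis by simp
  qed
qed

lemma binomial_eq: "varY ^ r - const2 x * varX ^ s = bimonom 1 0 r - bimonom x s 0"
  by (simp add: bimonom_eq flip: one_pCons)

lemma normal_order_binomial:
  "normal_order (varY ^ r - const2 x * varX ^ s) = weyl_q ^ r - weyl_scale x (weyl_p ^ s)"
  unfolding binomial_eq normal_order_diff normal_order_bimonom by simp

lemma (in weights) wle_binomial:
  assumes "\<rho> * int s \<le> n" "\<sigma> * int r \<le> n"
  shows "wle n (varY ^ r - const2 x * varX ^ s)"
  unfolding binomial_eq by (intro wle_diff) (use assms in \<open>simp_all add: wle_bimonom\<close>)

lemma (in weights) filt_const_mult_power:
  assumes "wle n g"
  shows "normal_order (const2 c * g ^ k) - weyl_scale c (normal_order g ^ k) \<in> filt (int k * n - 1)"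
proof -
  have "normal_order (const2 c * g ^ k) - weyl_scale c (normal_order g ^ k) =
      weyl_scale c (normal_order (g ^ k) - normal_order g ^ k)"
    by (simp add: normal_order_scale weyl.scale_right_diff_distrib)
  with filt_scale[OF normal_order_power[OF assms]] show ?thesis by simp
qed

text \<open>For d at least 3 the top form is locally nilpotent. If Y^d is missing, X divides it,
  lies in the kernel, and only X^d remains. Otherwise it is a multiple of Y^d or of (Y - x X)^d. The
  linear automorphisms that carry these forms to q^d do not raise the total degree.\<close>

lemma exists_Aut_leading_power_q:
  fixes f0 :: "'k::{alg_closed_field, field_char_0} poly poly"
  assumes fin: "locally_finite (normal_order (f0 + f1))"
    and f0: "total.whom (int d) f0" "f0 \<noteq> 0" and f1: "total.wle (int d - 1) f1" and d: "d \<ge> 3"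
  shows "\<exists>\<alpha>\<in>weyl_Aut. \<exists>c. c \<noteq> 0 \<and>
    \<alpha> (normal_order (f0 + f1)) - weyl_scale c (weyl_q ^ d) \<in> total.filt (int d - 1)"
proof -
  define c where "c k = cf f0 k (d - k)" for k
  have nil: "\<exists>k. (poisson f0 ^^ k) g = 0" for g
    by (rule total.leading_form_locally_nilpotent[OF fin f0(1) f1]) (use d in simp)
  have line: "f0 = (\<Sum>k\<le>d div 1. bimonom (c k) (1 * k) (d - 1 * k))"
    using weights_line_form[of 1 1 d f0] f0(1) by (simp add: c_def)
  have lin: "fourier z \<in> total.filt n" "shear_q [:0, x:] z \<in> total.filt n" if "z \<in> total.filt n"
    for z :: "'k weyl" and n x
  proof -
    have p: "(weyl_p :: 'k weyl) \<in> total.filt 1"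
      using total.filt_normal_order_iff[of "bimonom (1 :: 'k) 1 0" 1]
      by (simp add: normal_order_bimonom total.wle_bimonom)
    have q: "(weyl_q :: 'k weyl) \<in> total.filt 1"
      using total.filt_normal_order_iff[of "bimonom (1 :: 'k) 0 1" 1]
      by (simp add: normal_order_bimonom total.wle_bimonom)
    show "fourier z \<in> total.filt n"
      by (rule total.filt_hom[OF elementary_hom(3) _ _ that])
         (use p q total.filt_scale[OF p, of "-1"] in simp_all)
    show "shear_q [:0, x:] z \<in> total.filt n"
      by (rule total.filt_hom[OF elementary_hom(1) _ _ that])
         (use p q total.filt_scale[OF p, of x] in \<open>simp_all add: weyl_scale_mult_right total.filt_add\<close>)
  qed
  show ?thesis
  proof (cases "c 0 = 0")
    case True
    have "cf f0 i j = 0" if "j > 0" for i j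
    proof (rule ccontr)
      assume nz: "cf f0 i j \<noteq> 0"
      interpret D: locally_nilpotent_derivation "poisson f0"
        by unfold_locales (use nil in \<open>auto simp: poisson_add_right poisson_mult_right\<close>)
      have "f0 = varX * (\<Sum>k\<in>{1..d}. bimonom (c k) (k - 1) (d - k))"
      proof -
        have "f0 = (\<Sum>k\<in>{1..d}. bimonom (c k) k (d - k))"
          unfolding line by (rule sum.mono_neutral_cong_right) (use True in \<open>auto simp: not_less_eq_eq\<close>)
        also have "\<dots> = (\<Sum>k\<in>{1..d}. varX * bimonom (c k) (k - 1) (d - k))"
          unfolding varX_eq bimonom_mult by (intro sum.cong) auto
        finally show ?thesis by (simp only: sum_distrib_left)
      qed
      with D.kernel_factor f0(2) have "poisson f0 varX = 0" by (metis poisson_self)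
      then have "cf (dY f0) i (j - 1) = 0" by (simp add: poisson_simps)
      with nz that show False by (simp add: cf_dY flip: of_nat_Suc)
    qed
    then have "f0 = bimonom (c d) d 0"
      using total.whomD[OF f0(1)] by (intro cf_eqI) (force simp: cf_bimonom c_def)
    with f0(2) have "c d \<noteq> 0" "normal_order f0 = weyl_scale (c d) (weyl_p ^ d)"
      by (auto simp: normal_order_bimonom)
    moreover from this have "fourier (normal_order (f0 + f1)) - weyl_scale (c d) (weyl_q ^ d) = fourier (normal_order f1)"
      by (simp add: normal_order_add elementary_simps)
    ultimately show ?thesis using lin(1) f1 elementary_Aut(3) by (metis total.filt_normal_order_iff)
  next
    case False
    from homogeneous_locally_nilpotent[OF line _ _ _ False nil] d
    consider "f0 = bimonom (c 0) 0 d" | x where "f0 = const2 (c 0) * (varY ^ 1 - const2 x * varX ^ 1) ^ d"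
      by auto
    then show ?thesis
    proof cases
      case 1
      then have "id (normal_order (f0 + f1)) - weyl_scale (c 0) (weyl_q ^ d) = normal_order f1"
        by (simp add: normal_order_add normal_order_bimonom)
      with f1 False weyl_Aut_id show ?thesis by (metis total.filt_normal_order_iff)
    next
      case 2
      let ?g = "varY ^ 1 - const2 x * varX ^ 1" and ?z = "normal_order (f0 + f1)"
      have "total.wle 1 ?g" by (rule total.wle_binomial) simp_all
      from total.filt_const_mult_power[OF this, of "c 0" d] 2
      have "normal_order f0 - weyl_scale (c 0) ((weyl_q - weyl_scale x weyl_p) ^ d) \<in> total.filt (int d - 1)"
        unfolding normal_order_binomial by simp
      from total.filt_add[OF this, of "normal_order f1"] f1
      have "?z - weyl_scale (c 0) ((weyl_q - weyl_scale x weyl_p) ^ d) \<in> total.filt (int d - 1)"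
        by (simp add: normal_order_add algebra_simps)
      from lin(2)[OF this, of x] show ?thesis
        using False elementary_Aut(1)
        by (intro bexI[of _ "shear_q [:0, x:]"] exI[of _ "c 0"])
           (simp_all add: elementary_simps weyl_scale_mult_right)
    qed
  qed
qed

text \<open>The edge of the Newton polygon of \<open>q\<^sup>d + f\<close> that starts at \<open>(0, d)\<close>.\<close>

lemma Newton_edge:
  fixes f :: "'k::field_char_0 poly poly"
  assumes f1: "total.wle (int d - 1) f" and S: "cf f i j \<noteq> 0" "i > 0"
  obtains a b r s where "cf f a b \<noteq> 0" "a > 0" "coprime r s" "s > 0" "r > s" "r * a + s * b = s * d"
    "\<And>i j. cf f i j \<noteq> 0 \<Longrightarrow> r * i + s * j \<le> s * d"
proof -
  let ?S = "{(i, j). cf f i j \<noteq> 0 \<and> i > 0}"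
  have "finite ?S" by (rule finite_subset[OF _ finite_cf_support[of f]]) auto
  moreover have "?S \<noteq> {}" using S by auto
  \<comment> \<open>Minimizing (d - j) / i selects a line through (0, d) with the entire support on
    or below it. In lowest terms the minimum is r / s, which supplies the weights.\<close>
  ultimately obtain t where t: "t \<in> ?S" "\<And>u. u \<in> ?S \<Longrightarrow>
      (rat_of_nat d - rat_of_nat (snd t)) / rat_of_nat (fst t) \<le> (rat_of_nat d - rat_of_nat (snd u)) / rat_of_nat (fst u)"
    using ex_is_arg_min_if_finite[of ?S "\<lambda>t. (rat_of_nat d - rat_of_nat (snd t)) / rat_of_nat (fst t)"]
    by (auto simp: is_arg_min_linorder)
  obtain a b where ab: "t = (a, b)" by (cases t)
  have lt: "i + j < d" if "cf f i j \<noteq> 0" for i j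
    using total.wleD[OF f1 that] by simp
  define g where "g = gcd (d - b) a"
  from t(1) ab have a: "a > 0" "cf f a b \<noteq> 0" by auto
  then have "g > 0" by (simp add: g_def)
  then obtain r s where rs: "d - b = r * g" "a = s * g" "coprime r s"
    unfolding g_def using gcd_coprime_exists[of "d - b" a] by auto
  have "s > 0" using a rs by (cases s) auto
  have "a < d - b" using lt[OF a(2)] by simp
  then have "r > s" using rs \<open>g > 0\<close> by simp
  have "g * (r * a + s * b) = a * (d - b) + a * b" using rs by (simp add: algebra_simps)
  also have "\<dots> = a * d" using lt[OF a(2)] by (simp flip: distrib_left)
  also have "\<dots> = g * (s * d)" using rs by simp
  finally have edge: "r * a + s * b = s * d" using \<open>g > 0\<close> by simp
  have "r * i + s * j \<le> s * d" if nz: "cf f i j \<noteq> 0" for i j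
  proof (cases "i = 0")
    case True
    then show ?thesis using lt[OF nz] by simp
  next
    case False
    with t(2)[of "(i, j)"] nz ab a have
      "(rat_of_nat d - rat_of_nat b) * rat_of_nat i \<le> (rat_of_nat d - rat_of_nat j) * rat_of_nat a"
      by (simp add: field_simps)
    moreover have "rat_of_nat d - rat_of_nat b = rat_of_nat (d - b)" "rat_of_nat d - rat_of_nat j = rat_of_nat (d - j)"
      using lt[OF a(2)] lt[OF nz] by (simp_all add: of_nat_diff)
    ultimately have "(d - b) * i \<le> (d - j) * a"
      by (metis of_nat_le_iff of_nat_mult)
    then have "g * (r * i) \<le> g * (s * (d - j))" using rs by (simp add: algebra_simps)
    then have "r * i \<le> s * (d - j)" using \<open>g > 0\<close> by simp
    then have "r * i \<le> s * d - s * j" by (simp add: diff_mult_distrib2)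
    moreover have "s * j \<le> s * d" by (rule mult_le_mono2) (use lt[OF nz] in simp)
    ultimately show ?thesis by linarith
  qed
  with that a edge rs \<open>s > 0\<close> \<open>r > s\<close> show thesis by blast
qed

text \<open>The edge form turns out to be a multiple of a power of Y^r - x X with r at least 2. A
  shear replaces it by a power of p of exponent at most d/2, and everything below the edge keeps
  total degree less than d, so the induction hypothesis applies.\<close>

lemma normalizable_leading_power_q:
  fixes f1 :: "'k::{alg_closed_field, field_char_0} poly poly"
  assumes fin: "locally_finite (normal_order (bimonom c 0 d + f1))" and c: "c \<noteq> 0"
    and f1: "total.wle (int d - 1) f1" and d: "d > 0"
    and IH: "\<And>z :: 'k weyl. z \<in> total.filt (int d - 1) \<Longrightarrow> locally_finite z \<Longrightarrow> normalizable z"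
  shows "normalizable (normal_order (bimonom c 0 d + f1))"
proof -
  define f where "f = bimonom c 0 d + f1"
  have cf_f: "cf f i j = cf f1 i j" if "i > 0" for i j
    using that by (simp add: f_def cf_add cf_bimonom)
  show ?thesis
  proof (cases "\<forall>i j. cf f1 i j \<noteq> 0 \<longrightarrow> i > 0 \<longrightarrow> i = 1 \<and> j \<le> 1")
    case True
    show ?thesis
      unfolding f_def[symmetric]
    proof (rule normalizable_if_support)
      fix i j assume "cf f i j \<noteq> 0" "i > 0"
      with True cf_f[of i j] show "i = 1 \<and> j \<le> 1" by metis
    qed
  next
    case False
    then obtain i0 j0 where ij0: "cf f1 i0 j0 \<noteq> 0" "i0 > 0" "\<not> (i0 = 1 \<and> j0 \<le> 1)" by blast
    obtain a b r s where ab: "cf f1 a b \<noteq> 0" "a > 0" and rs: "coprime r s" "s > 0" "r > s"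
      and edge: "r * a + s * b = s * d" and below: "\<And>i j. cf f1 i j \<noteq> 0 \<Longrightarrow> r * i + s * j \<le> s * d"
      using Newton_edge[OF f1 ij0(1,2)] by metis
    interpret W: weights "int r" "int s" by unfold_locales (use rs in simp)
    have "W.wle (int (s * d)) f1"
      using below by (intro W.wleI) (metis of_nat_add of_nat_le_iff of_nat_mult)
    then have "W.wle (int (s * d)) f"
      unfolding f_def by (intro W.wle_add) (simp_all add: W.wle_bimonom)
    then obtain g h where gh: "f = g + h" "W.whom (int (s * d)) g" "W.wle (int (s * d) - 1) h"
      by (rule W.wle_decompose)
    \<comment> \<open>This is where the excluded term enters: as r > s > 0, an exponent pair with i
      > 0 and weight at most r + s is (1, 0) or (1, 1).\<close>
    have big: "int r + int s < int (s * d)"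
    proof (rule ccontr)
      assume "\<not> int r + int s < int (s * d)"
      then have "\<not> r + s < s * d" by (metis of_nat_add of_nat_less_iff)
      with below[OF ij0(1)] have le: "r * i0 + s * j0 \<le> r + s" by linarith
      show False
      proof (cases "i0 = 1")
        case True
        with le rs ij0 show False by simp
      next
        case False
        with ij0 have "r * 2 \<le> r * i0" by (intro mult_le_mono) auto
        with le rs show False by simp
      qed
    qed
    have "cf g 0 d = cf f 0 d" using W.cf_whom_add_wle[OF gh(3), of 0 d g] gh(1) by simp
    also have "cf f1 0 d = 0" using total.wleD[OF f1, of 0 d] by force
    then have "cf f 0 d = c" by (simp add: f_def cf_add cf_bimonom)
    finally have g0: "cf g 0 d = c" .
    have "cf g a b = cf f a b"
      using W.cf_whom_add_wle[OF gh(3), of a b g] gh(1) edge by (metis of_nat_add of_nat_mult)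
    then have gab: "cf g a b \<noteq> 0" using ab cf_f by simp
    have nil: "\<exists>k. (poisson g ^^ k) u = 0" for u
      by (rule W.leading_form_locally_nilpotent[OF _ gh(2,3) big]) (use fin gh(1) f_def in simp)
    define e where "e k = cf g (s * k) (d - r * k)" for k
    have line: "g = (\<Sum>k\<le>d div r. bimonom (e k) (s * k) (d - r * k))"
      unfolding e_def by (rule weights_line_form) (use rs gh in auto)
    have e0: "e 0 = c" by (simp add: e_def g0)
    \<comment> \<open>The other point (a, b) on the edge survives in \<open>g\<close> and excludes
      the monomial alternative; r > s then leaves s = 1.\<close>
    have "g \<noteq> bimonom c 0 d" using gab ab by (auto simp: cf_bimonom)
    with homogeneous_locally_nilpotent[OF line _ _ d _ nil] rs c e0 obtain x where x: "x \<noteq> 0" "r dvd d"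
      "r = 1 \<or> s = 1" "g = const2 c * (varY ^ r - const2 x * varX ^ s) ^ (d div r)"
      by auto
    have "s = 1" "r \<ge> 2" using x(3) rs by auto
    define M where "M = d div r"
    have dM: "d = r * M" using x(2) by (simp add: M_def)
    let ?q = "varY ^ r - const2 x * varX ^ s :: 'k poly poly"
    have "W.wle (int r) ?q" by (rule W.wle_binomial) (simp_all add: \<open>s = 1\<close>)
    from W.filt_const_mult_power[OF this, of c M]
    have "normal_order g - weyl_scale c (normal_order ?q ^ M) \<in> W.filt (int d - 1)"
      unfolding x(4)[folded M_def] by (simp add: dM mult.commute del: mult_pCons_left)
    then have "normal_order g - weyl_scale c ((weyl_q ^ r - weyl_scale x weyl_p) ^ M) \<in> W.filt (int d - 1)"
      unfolding normal_order_binomial by (simp add: \<open>s = 1\<close>)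
    moreover have "normal_order h \<in> W.filt (int d - 1)"
      using gh(3) \<open>s = 1\<close> W.filt_normal_order_iff[of h "int d - 1"] by (metis mult_1)
    ultimately have "normal_order g - weyl_scale c ((weyl_q ^ r - weyl_scale x weyl_p) ^ M) + normal_order h
        \<in> W.filt (int d - 1)"
      by (rule W.filt_add)
    then have rest: "normal_order f - weyl_scale c ((weyl_q ^ r - weyl_scale x weyl_p) ^ M) \<in> W.filt (int d - 1)"
      by (simp add: gh(1) normal_order_add algebra_simps)
    \<comment> \<open>It sends p to p + q^r / x and therefore q^r - x p to - x p.\<close>
    let ?\<alpha> = "shear_p (monom (inverse x) r)"
    have poly: "weyl_poly (monom (inverse x) r) weyl_q = weyl_scale (inverse x) (weyl_q ^ r)"
      by (induction r) (simp_all add: monom_0 monom_Suc weyl_scale_mult_right)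
    have p: "(weyl_p :: 'k weyl) \<in> W.filt (int r)"
      using W.filt_normal_order_iff[of "bimonom (1 :: 'k) 1 0" "int r"]
      by (simp add: normal_order_bimonom W.wle_bimonom)
    have q: "(weyl_q :: 'k weyl) ^ n \<in> W.filt (int n)" for n
    proof -
      have "W.wle (int n) (bimonom (1 :: 'k) 0 n)"
        unfolding W.wle_bimonom by (simp add: \<open>s = 1\<close>)
      from W.filt_normal_order_iff[THEN iffD2, OF this] show ?thesis
        by (simp add: normal_order_bimonom)
    qed
    have "?\<alpha> weyl_p \<in> W.filt (int r)"
      unfolding elementary_generators poly by (intro W.filt_add W.filt_scale p q)
    moreover have "?\<alpha> weyl_q \<in> W.filt (int s)"
      using q[of 1] by (simp add: \<open>s = 1\<close>)
    ultimately have "?\<alpha> (normal_order f - weyl_scale c ((weyl_q ^ r - weyl_scale x weyl_p) ^ M)) \<in> W.filt (int d - 1)"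
      using rest by (rule W.filt_hom[OF elementary_hom(2)])
    moreover have "?\<alpha> (normal_order f - weyl_scale c ((weyl_q ^ r - weyl_scale x weyl_p) ^ M)) =
        ?\<alpha> (normal_order f) - weyl_scale c (weyl_scale (- x) weyl_p ^ M)"
      using x(1) by (simp add: elementary_simps poly weyl.scale_right_distrib)
    ultimately obtain u where u: "W.wle (int d - 1) u"
      "?\<alpha> (normal_order f) = weyl_scale c (weyl_scale (- x) weyl_p ^ M) + normal_order u"
      by (metis W.filtE add.commute diff_add_cancel)
    \<comment> \<open>For weights (r, 1) with r at least 1 the total degree is bounded by the
      weight.\<close>
    have "total.wle (int d - 1) u"
    proof (rule total.wleI)
      fix i j assume "cf u i j \<noteq> 0"
      from W.wleD[OF u(1) this] have "int r * int i + int j \<le> int d - 1" using \<open>s = 1\<close> by simp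
      moreover have "1 * int i \<le> int r * int i" using \<open>r \<ge> 2\<close> by (intro mult_right_mono) auto
      ultimately show "1 * int i + 1 * int j \<le> int d - 1" by linarith
    qed
    moreover have "weyl_scale c (weyl_scale (- x) weyl_p ^ M) \<in> total.filt (int d - 1)"
    proof -
      have "(weyl_p :: 'k weyl) \<in> total.filt 1"
        using total.filt_normal_order_iff[of "bimonom (1 :: 'k) 1 0" 1]
        by (simp add: normal_order_bimonom total.wle_bimonom)
      then have "weyl_scale c (weyl_scale (- x) weyl_p ^ M) \<in> total.filt (int M * 1)"
        by (intro total.filt_scale total.filt_power)
      moreover have "2 * M \<le> d" using dM \<open>r \<ge> 2\<close> by simp
      ultimately show ?thesis using d by (elim total.filt_mono) linarith
    qed
    ultimately have "?\<alpha> (normal_order f) \<in> total.filt (int d - 1)"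
      unfolding u(2) by (intro total.filt_add) simp_all
    moreover have "locally_finite (?\<alpha> (normal_order f))"
      by (rule locally_finite_Aut[OF elementary_Aut(2)]) (use fin in \<open>simp add: f_def\<close>)
    ultimately have "normalizable (?\<alpha> (normal_order f))" by (rule IH)
    then show ?thesis unfolding f_def[symmetric] by (rule normalizable_Aut[OF elementary_Aut(2)])
  qed
qed

theorem locally_finite_normalizable:
  fixes z :: "'k::{alg_closed_field, field_char_0} weyl"
  assumes "locally_finite z"
  shows "normalizable z"
proof -
  have "normalizable z" if "z \<in> total.filt (int d)" "locally_finite z" for d and z :: "'k weyl"
    using that
  proof (induction d arbitrary: z)
    case 0
    then show ?case
      by (metis normalizable_quadratic of_nat_0 total.filtE total.wle_mono zero_le_numeral)
  next
    case (Suc d)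
    from Suc.prems(1) obtain f where f: "total.wle (int (Suc d)) f" "z = normal_order f"
      by (rule total.filtE)
    show ?case
    proof (cases "Suc d \<le> 2")
      case True
      with f total.wle_mono[OF f(1), of 2] show ?thesis by (simp add: normalizable_quadratic)
    next
      case False
      from f(1) obtain g h where gh: "f = g + h" "total.whom (int (Suc d)) g" "total.wle (int (Suc d) - 1) h"
        by (rule total.wle_decompose)
      have IH: "normalizable z" if "z \<in> total.filt (int (Suc d) - 1)" "locally_finite z" for z :: "'k weyl"
        using Suc.IH that by simp
      show ?thesis
      proof (cases "g = 0")
        case True
        with gh f Suc.prems IH show ?thesis by simp
      next
        case g: False
        obtain \<alpha> c where \<alpha>: "\<alpha> \<in> weyl_Aut" "c \<noteq> 0"
          "\<alpha> (normal_order (g + h)) - weyl_scale c (weyl_q ^ Suc d) \<in> total.filt (int (Suc d) - 1)"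
          using exists_Aut_leading_power_q[OF _ gh(2) g gh(3)] Suc.prems(2) f gh(1) False by fastforce
        from \<alpha>(3) obtain u where u: "total.wle (int (Suc d) - 1) u"
          "\<alpha> (normal_order (g + h)) - weyl_scale c (weyl_q ^ Suc d) = normal_order u"
          by (rule total.filtE)
        then have \<alpha>z: "\<alpha> z = normal_order (bimonom c 0 (Suc d) + u)"
          using f gh(1) by (simp add: normal_order_add normal_order_bimonom algebra_simps)
        have "normalizable (\<alpha> z)"
          unfolding \<alpha>z
          by (rule normalizable_leading_power_q)
             (use \<alpha>z locally_finite_Aut[OF \<alpha>(1) Suc.prems(2)] \<alpha>(2) u(1) IH in auto)
        with \<alpha>(1) show ?thesis by (rule normalizable_Aut)
      qed
    qed
  qed
  moreover obtain f where f: "z = normal_order f" using normal_order_surj by blast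
  moreover obtain n where "total.wle n f" using total.exists_wle by blast
  then have "total.wle (int (nat n)) f" by (rule total.wle_mono) simp
  ultimately show ?thesis using assms by (metis total.filt_normal_order_iff)
qed

section \<open>Surjectivity\<close>

lemma normal_form_cases:
  assumes "normal_form z"
  obtains u where "z = normal_order (inY u)"
    | c d where "c \<noteq> 0" "z = weyl_scale c (weyl_p * weyl_q) + weyl_scale d 1"
  using assms unfolding normal_form_def normal_order_inY by blast

section \<open>Degree in p and commutators with polynomials in q\<close>

interpretation pdeg: weights 1 0
  by unfold_locales simp

lemma pdeg_wle_imp_whom: "pdeg.wle 0 f \<Longrightarrow> pdeg.whom 0 f"
  by (rule pdeg.whomI) (use pdeg.wleD[of 0 f] in force)

text \<open>Exponents are nonnegative, so weight at most 0 means that p does not occur; likewise a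
  negative bound leaves only 0, which is how vanishing is detected below.\<close>

lemma pdeg_wle_0_inY: "pdeg.wle 0 f \<longleftrightarrow> (\<exists>u. f = inY u)"
proof
  assume "pdeg.wle 0 f"
  then have "f = inY (partY f)"
    by (intro cf_eqI) (force simp: cf_inY coeff_partY dest: pdeg.wleD)
  then show "\<exists>u. f = inY u" ..
qed (auto simp: pdeg.wle_def cf_inY split: if_splits)

lemma dY_inY: "dY (inY u) = inY (pderiv u)" and dX_inY: "dX (inY u) = 0"
  by (rule cf_eqI; simp add: cf_dY cf_dX cf_inY coeff_pderiv)+

lemma inY_eq_0_iff [simp]: "inY u = 0 \<longleftrightarrow> u = 0"
proof
  assume "inY u = 0"
  then have "coeff u j = 0" for j using cf_inY[of u 0 j] by simp
  then show "u = 0" by (simp add: poly_eq_iff)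
qed (simp add: inY_def)

lemma ad_inY:
  assumes "pdeg.wle n f"
  shows "\<exists>r. pdeg.wle (n - 2) r \<and>
    ad (normal_order (inY u)) (normal_order f) = normal_order (inY (pderiv u) * dX f + r)"
proof -
  have "pdeg.wle 0 (inY u)" by (simp only: pdeg_wle_0_inY) blast
  from pdeg.normal_order_commutator[OF this assms] show ?thesis
    by (simp add: poisson_def dY_inY dX_inY)
qed

lemma ad_inY_filt:
  assumes "x \<in> pdeg.filt n"
  shows "ad (normal_order (inY u)) x \<in> pdeg.filt (n - 1)"
proof -
  from assms obtain f where f: "pdeg.wle n f" "x = normal_order f" by (rule pdeg.filtE)
  from ad_inY[OF f(1), of u] obtain r where r: "pdeg.wle (n - 2) r"
    "ad (normal_order (inY u)) x = normal_order (inY (pderiv u) * dX f + r)"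
    using f by blast
  have "pdeg.wle 0 (inY (pderiv u))" by (simp only: pdeg_wle_0_inY) blast
  from pdeg.wle_mult[OF this pdeg.wle_dX[OF f(1)]]
  have "pdeg.wle (n - 1) (inY (pderiv u) * dX f + r)"
    using pdeg.wle_mono[OF r(1), of "n - 1"] by (intro pdeg.wle_add) simp_all
  with r show ?thesis by simp
qed

text \<open>The leading coefficient in \<open>p\<close> survives because \<open>pderiv u \<noteq> 0\<close>.\<close>

lemma ad_inY_degree:
  assumes u: "pderiv u \<noteq> 0" and ad: "ad (normal_order (inY u)) (normal_order f) \<in> pdeg.filt n"
    and n: "n \<ge> -1"
  shows "pdeg.wle (n + 1) f"
proof -
  have "pdeg.wle (n + 1) f" if "pdeg.wle (n + 1 + int k) f" for k
    using that
  proof (induction k)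
    case (Suc k)
    let ?m = "n + 1 + int (Suc k)"
    obtain g h where gh: "f = g + h" "pdeg.whom ?m g" "pdeg.wle (?m - 1) h"
      by (rule pdeg.wle_decompose[OF Suc.prems])
    obtain r where r: "pdeg.wle (?m - 2) r"
      "ad (normal_order (inY u)) (normal_order f) = normal_order (inY (pderiv u) * dX f + r)"
      using ad_inY[OF Suc.prems, of u] by blast
    have w: "pdeg.whom 0 (inY (pderiv u))"
      by (rule pdeg_wle_imp_whom) (simp only: pdeg_wle_0_inY, blast)
    have "pdeg.wle n (inY (pderiv u) * dX f + r)" using ad r(2) by simp
    then have "pdeg.wle (?m - 2) (inY (pderiv u) * dX f + r)" by (rule pdeg.wle_mono) simp
    moreover have "pdeg.wle (?m - 2) (inY (pderiv u) * dX h)"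
      using pdeg.wle_mult[OF pdeg.whom_imp_wle[OF w] pdeg.wle_dX[OF gh(3)]] by simp
    ultimately have "pdeg.wle (?m - 2) (inY (pderiv u) * dX f + r - r - inY (pderiv u) * dX h)"
      by (intro pdeg.wle_diff r(1))
    also have "inY (pderiv u) * dX f + r - r - inY (pderiv u) * dX h = inY (pderiv u) * dX g"
      by (simp add: gh(1) dX_add algebra_simps)
    finally have "inY (pderiv u) * dX g = 0"
      using pdeg.whom_wle_eq_0[OF pdeg.whom_mult[OF w pdeg.whom_dX[OF gh(2)]]] by simp
    with u have dXg: "dX g = 0" by simp
    \<comment> \<open>Since n is at least -1, the weight \<open>?m\<close> is at least 1, so every
      term of \<open>g\<close> contains X and is detected by \<open>dX\<close>.\<close>
    have "g = 0"
    proof (rule cf_eqI)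
      fix i j
      show "cf g i j = cf 0 i j"
      proof (cases i)
        case 0
        then show ?thesis using pdeg.whomD[OF gh(2), of i j] n by force
      next
        case (Suc i')
        then show ?thesis using dXg cf_dX[of g i' j] by (simp del: of_nat_Suc)
      qed
    qed
    with gh(1,3) have "pdeg.wle (?m - 1) f" by simp
    then have "pdeg.wle (n + 1 + int k) f" by (rule pdeg.wle_mono) simp
    then show ?case by (rule Suc.IH)
  qed simp
  moreover obtain m where "pdeg.wle m f" using pdeg.exists_wle by blast
  then have "pdeg.wle (n + 1 + int (nat (m - (n + 1)))) f" by (rule pdeg.wle_mono) simp
  ultimately show ?thesis by blast
qed

lemma ad_scalar: "ad (weyl_scale c 1) x = 0" and ad_1: "ad 1 x = 0"
  by (simp_all add: ad_def weyl_scale_mult_left weyl_scale_mult_right)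

lemma ad_add_left: "ad (y + z) x = ad y x + ad z x"
  and ad_scale_left: "ad (weyl_scale c z) x = weyl_scale c (ad z x)"
  by (simp_all add: ad_def algebra_simps weyl_scale_mult_left weyl_scale_mult_right
      weyl.scale_right_diff_distrib)

lemma normal_order_inY_central:
  assumes "ad (normal_order (inY u)) x \<noteq> 0"
  shows "pderiv u \<noteq> 0"
proof
  assume "pderiv u = 0"
  then obtain c where "u = [:c:]" using degree_eq_zeroE by (auto simp: pderiv_eq_0_iff)
  then have "normal_order (inY u) = weyl_scale c 1" by (simp add: normal_order_inY)
  with assms show False by (simp add: ad_scalar)
qed

section \<open>Commutators with p q\<close>

lemma normal_order_mult_q: "normal_order f * weyl_q = normal_order (varY * f)"
  by simp

text \<open>Each of the two products involves a single contraction, so the formula is exact: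
  \<open>ad (p q)\<close> is a signed Euler operator, diagonal on the monomials X^i Y^j with
  eigenvalue i - j.\<close>

lemma ad_pq:
  "ad (weyl_p * weyl_q) (normal_order f) = normal_order (varX * dX f - varY * dY f)"
proof -
  have "weyl_p * weyl_q * normal_order f = normal_order (varX * (varY * f + dX f))"
    by (simp only: mult.assoc q_mult_normal_order p_mult_normal_order)
  moreover have "normal_order f * (weyl_p * weyl_q) = normal_order (varY * (varX * f + dY f))"
    by (simp only: normal_order_mult_p normal_order_mult_q flip: mult.assoc)
  ultimately show ?thesis
    unfolding ad_def by (simp only: normal_order_diff[symmetric])
      (simp add: algebra_simps del: mult_pCons_left mult_pCons_right)
qed

lemma cf_varX_mult: "cf (varX * f) i j = (case i of 0 \<Rightarrow> 0 | Suc i' \<Rightarrow> cf f i' j)"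
  and cf_varY_mult: "cf (varY * f) i j = (case j of 0 \<Rightarrow> 0 | Suc j' \<Rightarrow> cf f i j')"
  by (simp_all add: cf_def coeff_pCons split: nat.split)

lemma cf_euler: "cf (varX * dX f - varY * dY f) i j = (of_nat i - of_nat j) * cf f i j"
proof -
  have "cf (varX * dX f) i j = of_nat i * cf f i j"
    by (cases i) (simp_all only: cf_varX_mult nat.case cf_dX of_nat_0 mult_zero_left)
  moreover have "cf (varY * dY f) i j = of_nat j * cf f i j"
    by (cases j) (simp_all only: cf_varY_mult nat.case cf_dY of_nat_0 mult_zero_left)
  moreover have "cf (g - h) i j = cf g i j - cf h i j" for g h :: "'a poly poly"
    by (simp add: cf_def)
  ultimately show ?thesis by (simp only: left_diff_distrib)
qed

lemma ad_affine_pq: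
  obtains g where "ad (weyl_scale c (weyl_p * weyl_q) + weyl_scale d 1) (normal_order f) = normal_order g"
    "\<And>i j. cf g i j = c * (of_nat i - of_nat j) * cf f i j"
proof
  let ?g = "smult [:c:] (varX * dX f - varY * dY f)"
  show "ad (weyl_scale c (weyl_p * weyl_q) + weyl_scale d 1) (normal_order f) = normal_order ?g"
    by (simp add: ad_add_left ad_scale_left ad_1 ad_pq normal_order_scale del: mult_pCons_left)
  show "cf ?g i j = c * (of_nat i - of_nat j) * cf f i j" for i j
    by (simp only: cf_smult cf_euler mult.assoc)
qed

lemma ad_affine_pq_p:
  "ad (weyl_scale c (weyl_p * weyl_q) + weyl_scale d 1) weyl_p = weyl_scale c weyl_p"
  "ad (weyl_scale c (weyl_p * weyl_q) + weyl_scale d 1) weyl_q = weyl_scale (- c) weyl_q"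
proof -
  have "weyl_q * (weyl_p * x) = weyl_p * (weyl_q * x) + x" for x :: "'a weyl"
    by (simp add: weyl_relation' distrib_right flip: mult.assoc)
  then show "ad (weyl_scale c (weyl_p * weyl_q) + weyl_scale d 1) weyl_p = weyl_scale c weyl_p"
    "ad (weyl_scale c (weyl_p * weyl_q) + weyl_scale d 1) weyl_q = weyl_scale (- c) weyl_q"
    unfolding ad_add_left ad_scale_left ad_1
    by (simp_all add: ad_def weyl_relation' algebra_simps)
qed

lemma (in weights) exists_leading:
  assumes "f \<noteq> 0"
  shows "\<exists>m f0 f1. f = f0 + f1 \<and> f0 \<noteq> 0 \<and> whom m f0 \<and> wle (m - 1) f1"
proof -
  let ?S = "{(i, j). cf f i j \<noteq> 0}"
  let ?d = "\<lambda>(i, j). \<rho> * int i + \<sigma> * int j"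
  define m where "m = Max (?d ` ?S)"
  have "?S \<noteq> {}" using assms by (auto intro: cf_eqI)
  then have "m \<in> ?d ` ?S" unfolding m_def using finite_cf_support[of f] by (intro Max_in) auto
  then obtain i j where ij: "cf f i j \<noteq> 0" "\<rho> * int i + \<sigma> * int j = m" by auto
  have "wle m f"
  proof (rule wleI)
    fix i j assume "cf f i j \<noteq> 0"
    then have "?d (i, j) \<in> ?d ` ?S" by (intro imageI) simp
    then have "?d (i, j) \<le> m" unfolding m_def by (intro Max_ge finite_imageI finite_cf_support)
    then show "\<rho> * int i + \<sigma> * int j \<le> m" by simp
  qed
  then obtain f0 f1 where f: "f = f0 + f1" "whom m f0" "wle (m - 1) f1" by (rule wle_decompose)
  then have "cf f0 i j \<noteq> 0" using cf_whom_add_wle[OF f(3) ij(2), of f0] ij(1) by simp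
  with f show ?thesis by (metis cf_0)
qed

lemma weyl_scale_cancel: "c \<noteq> 0 \<Longrightarrow> weyl_scale (inverse c) (weyl_scale c x) = x"
  by simp

section \<open>Homomorphisms between normal forms\<close>

context
  fixes \<phi> :: "'k::field_char_0 weyl \<Rightarrow> 'k weyl"
  assumes hom: "weyl_hom \<phi>"
begin

lemma weyl_hom_eq_0_iff: "\<phi> x = 0 \<longleftrightarrow> x = 0"
  using weyl_hom_inj[OF hom] weyl_hom_simps(4)[OF hom] by (metis injD)

text \<open>With t(q) the image of q, the relation [t(q), \<phi>(p)] = 1 bounds the degree of
  \<phi>(p) in p by 1 and makes t' a unit. Hence \<phi>(q) = c q + t(0) and \<phi>(p) = p / c +
  h(q), which can be solved for p and q.\<close>

lemma surj_nilpotent_nilpotent: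
  assumes \<phi>: "\<phi> (weyl_poly v weyl_q) = weyl_poly u weyl_q" and u: "pderiv u \<noteq> 0"
  shows "surj \<phi>"
proof -
  obtain e g where e: "\<phi> weyl_p = normal_order e" and g: "\<phi> weyl_q = normal_order g"
    using normal_order_surj by metis
  have "ad (weyl_poly u weyl_q) (\<phi> weyl_q) = \<phi> (ad (weyl_poly v weyl_q) weyl_q)"
    by (simp add: weyl_hom_ad[OF hom] \<phi>)
  also have "\<dots> = 0"
    by (simp add: ad_def weyl_poly_commute weyl_hom_simps[OF hom])
  finally have "ad (normal_order (inY u)) (normal_order g) \<in> pdeg.filt (-1)"
    by (simp add: g normal_order_inY)
  from ad_inY_degree[OF u this] have "pdeg.wle 0 g" by simp
  then obtain t where t: "g = inY t" by (auto simp: pdeg_wle_0_inY)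
  have "ad weyl_q weyl_p = (1 :: 'k weyl)" by (simp add: ad_def weyl_relation)
  then have one: "ad (normal_order (inY t)) (normal_order e) = 1"
    using weyl_hom_ad[OF hom, of weyl_q weyl_p] by (simp add: e g t weyl_hom_simps(5)[OF hom])
  then have t': "pderiv t \<noteq> 0" by (intro normal_order_inY_central[of t "normal_order e"]) simp
  have "1 \<in> pdeg.filt 0" by (rule pdeg.filt_1)
  with one ad_inY_degree[OF t', of e 0] have e1: "pdeg.wle 1 e" by simp
  obtain r where r: "pdeg.wle (-1) r" "1 = normal_order (inY (pderiv t) * dX e + r)"
    using ad_inY[OF e1, of t] one by auto
  \<comment> \<open>Its degree in p is negative, so the commutator has no correction term and the
    derivatives multiply to exactly 1.\<close>
  have "r = 0" by (rule cf_eqI) (use pdeg.wleD[OF r(1)] in force)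
  have "normal_order 1 = (1 :: 'k weyl)" by (simp add: one_pCons)
  with r(2) \<open>r = 0\<close> have unit: "inY (pderiv t) * dX e = 1" by (metis add.right_neutral normal_order_eq_iff)
  then have "degree (inY (pderiv t)) + degree (dX e) = 0"
    by (metis degree_1 degree_mult_eq mult_not_zero one_neq_zero)
  then have deg: "degree (inY (pderiv t)) = 0" "degree (dX e) = 0" by simp_all
  define c where "c = coeff (pderiv t) 0"
  have const: "inY (pderiv t) = const2 c"
  proof (rule cf_eqI)
    fix i j show "cf (inY (pderiv t)) i j = cf (const2 c) i j"
    proof (cases j)
      case 0
      then show ?thesis by (simp add: cf_inY c_def) (simp add: cf_def coeff_pCons split: nat.split)
    next
      case (Suc j')
      with deg(1) have "cf (inY (pderiv t)) i j = 0" by (simp add: cf_def coeff_eq_0)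
      with Suc show ?thesis by (simp add: cf_def)
    qed
  qed
  have c: "c \<noteq> 0" using unit const by auto
  have "dX e = const2 (inverse c)"
  proof -
    have "const2 c * const2 (inverse c) = (1 :: 'k poly poly)" using c by (simp add: one_pCons)
    with unit const show ?thesis by (metis c mult_left_cancel mult_zero_left one_neq_zero)
  qed
  then have cf_dXe: "cf (dX e) i j = (if i = 0 \<and> j = 0 then inverse c else 0)" for i j
    by (simp add: cf_def coeff_pCons split: nat.split)
  have "e = bimonom (inverse c) 1 0 + inY (partY e)"
  proof (rule cf_eqI)
    fix i j show "cf e i j = cf (bimonom (inverse c) 1 0 + inY (partY e)) i j"
    proof (cases i)
      case 0
      then show ?thesis by (simp add: cf_add cf_bimonom cf_inY coeff_partY)
    next
      case (Suc i')
      have "i' = 0 \<or> cf e i j = 0" using pdeg.wleD[OF e1, of i j] Suc by force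
      with cf_dXe[of i' j] Suc show ?thesis
        by (auto simp: cf_dX cf_add cf_bimonom cf_inY)
    qed
  qed
  then have P: "\<phi> weyl_p = weyl_scale (inverse c) weyl_p + weyl_poly (partY e) weyl_q"
    by (metis e mult.right_neutral normal_order_add normal_order_bimonom normal_order_inY power_0 power_one_right)
  have "t = [:coeff t 0, c:]"
  proof (rule poly_eqI)
    fix j
    have "coeff (pderiv t) k = 0" if "k > 0" for k
      using const cf_inY[of "pderiv t" 0 k] that by (cases k) (auto simp: cf_def)
    then show "coeff t j = coeff [:coeff t 0, c:] j"
      by (cases j; cases "j - 1") (auto simp: coeff_pCons c_def coeff_pderiv split: nat.splits simp del: of_nat_Suc)
  qed
  then have "\<phi> weyl_q = weyl_scale (coeff t 0) 1 + weyl_scale c weyl_q"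
    using g t normal_order_inY[of t] weyl_poly_pCons[of "coeff t 0" "[:c:]" weyl_q]
    by (simp add: weyl_scale_mult_right)
  then have Q: "\<phi> (weyl_scale (inverse c) (weyl_q - weyl_scale (coeff t 0) 1)) = weyl_q"
    using c by (simp add: weyl_hom_simps[OF hom])
  then have "\<phi> (weyl_poly h (weyl_scale (inverse c) (weyl_q - weyl_scale (coeff t 0) 1))) = weyl_poly h weyl_q" for h
    by (simp add: weyl_hom_poly[OF hom])
  \<comment> \<open>The equation for \<phi>(p) is solved for p, with q replaced by its preimage
    found above.\<close>
  then have "\<phi> (weyl_scale c (weyl_p - weyl_poly (partY e)
      (weyl_scale (inverse c) (weyl_q - weyl_scale (coeff t 0) 1)))) = weyl_p"
    using c by (simp only: weyl_hom_simps[OF hom] P) simp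
  with Q show ?thesis by (intro weyl_hom_surjI[OF hom]) (metis rangeI)+
qed

text \<open>The image of p would be an eigenvector with nonzero eigenvalue of a derivation that
  lowers the degree in p. Its degree would lie below every bound, so it would vanish, against
  injectivity.\<close>

lemma not_semisimple_nilpotent:
  assumes "\<phi> (weyl_scale c (weyl_p * weyl_q) + weyl_scale d 1) = normal_order (inY u)" "c \<noteq> 0"
  shows False
proof -
  let ?P = "\<phi> weyl_p"
  have "ad (normal_order (inY u)) ?P = \<phi> (ad (weyl_scale c (weyl_p * weyl_q) + weyl_scale d 1) weyl_p)"
    by (simp only: weyl_hom_ad[OF hom] assms(1))
  also have "\<dots> = weyl_scale c ?P" by (simp only: ad_affine_pq_p weyl_hom_simps[OF hom])
  finally have eigen: "?P = weyl_scale (inverse c) (ad (normal_order (inY u)) ?P)"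
    using assms(2) by simp
  obtain e where e: "?P = normal_order e" using normal_order_surj by blast
  obtain n where "pdeg.wle n e" using pdeg.exists_wle by blast
  have "?P \<in> pdeg.filt (n - int k)" for k
  proof (induction k)
    case (Suc k)
    have "?P \<in> pdeg.filt (n - int k - 1)"
      by (subst eigen) (intro pdeg.filt_scale ad_inY_filt Suc)
    then show ?case by (simp add: algebra_simps)
  qed (simp add: e \<open>pdeg.wle n e\<close>)
  from this[of "nat (n + 1)"] have "?P \<in> pdeg.filt (-1)" by (rule pdeg.filt_mono) simp
  then have "pdeg.wle (-1) e" by (simp add: e)
  then have "e = 0" using pdeg.wleD[of "-1" e] by (intro cf_eqI) force
  with e have "weyl_p = (0 :: 'k weyl)" by (simp add: weyl_hom_eq_0_iff)
  with weyl_relation' show False by (metis add_0 mult_zero_left mult_zero_right one_neq_zero)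
qed

text \<open>Two applications of \<open>ad w\<close> lower the degree 1 of p below 0. So the square
  of the diagonal operator on the other side kills \<phi>(p), and then the operator itself does. By
  injectivity w commutes with p, hence is a scalar, although its image is not.\<close>

lemma not_nilpotent_semisimple:
  assumes \<phi>: "\<phi> (normal_order (inY v)) = weyl_scale c (weyl_p * weyl_q) + weyl_scale d 1" (is "_ = ?z")
    and c: "c \<noteq> 0"
  shows False
proof -
  let ?w = "normal_order (inY v)"
  have p: "weyl_p = normal_order (bimonom 1 1 0 :: 'k poly poly)" by (simp add: normal_order_bimonom)
  have "(weyl_p :: 'k weyl) \<in> pdeg.filt 1" unfolding p by (simp add: pdeg.wle_bimonom)
  from ad_inY_filt[OF ad_inY_filt[OF this, of v], of v] obtain f where
    "pdeg.wle (-1) f" "ad ?w (ad ?w weyl_p) = normal_order f" by (auto elim: pdeg.filtE)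
  moreover from this have "f = 0" using pdeg.wleD[of "-1" f] by (intro cf_eqI) force
  ultimately have "\<phi> (ad ?w (ad ?w weyl_p)) = 0" by (simp add: weyl_hom_simps[OF hom])
  then have "ad ?z (ad ?z (\<phi> weyl_p)) = 0" by (simp only: weyl_hom_ad[OF hom] \<phi>)
  moreover obtain e where "\<phi> weyl_p = normal_order e" using normal_order_surj by blast
  moreover obtain g where g: "ad ?z (normal_order e) = normal_order g"
    "\<And>i j. cf g i j = c * (of_nat i - of_nat j) * cf e i j" using ad_affine_pq[of c d e] by blast
  moreover obtain h where h: "ad ?z (normal_order g) = normal_order h"
    "\<And>i j. cf h i j = c * (of_nat i - of_nat j) * cf g i j" using ad_affine_pq[of c d g] by blast
  ultimately have "h = 0" by simp
  then have "g = 0" using h(2) g(2) by (intro cf_eqI) (metis cf_0 mult_eq_0_iff)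
  with g(1) \<open>\<phi> weyl_p = normal_order e\<close> have "\<phi> (ad ?w weyl_p) = 0"
    by (simp add: weyl_hom_ad[OF hom] \<phi>)
  then have "ad ?w weyl_p = 0" by (simp add: weyl_hom_eq_0_iff)
  then have "ad ?w (normal_order (bimonom 1 1 0)) \<in> pdeg.filt (-1)" unfolding p by simp
  then have "pderiv v = 0"
    using ad_inY_degree[of v "bimonom 1 1 0" "-1"] by (auto simp: pdeg.wle_bimonom)
  then obtain b where "v = [:b:]" using degree_eq_zeroE by (auto simp: pderiv_eq_0_iff)
  then have "?z = weyl_scale b 1" using \<phi> by (simp add: normal_order_inY weyl_hom_simps[OF hom])
  then have "weyl_scale c weyl_p = (0 :: 'k weyl)" using ad_affine_pq_p(1)[of c d] by (simp add: ad_scalar)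
  with c p show False by simp
qed

text \<open>The supports of \<phi>(p) and \<phi>(q) lie on the lines i - j = b/c and j - i = b/c,
  which miss the origin, so both have total degree at least 1. Their product has degree at most 2,
  so both degrees are 1. Hence b/c is 1 or -1, and p and q go to multiples of themselves or of each
  other.\<close>

lemma surj_semisimple_semisimple:
  assumes \<phi>: "\<phi> (weyl_scale b (weyl_p * weyl_q) + weyl_scale a 1) = weyl_scale c (weyl_p * weyl_q) + weyl_scale d 1"
      (is "\<phi> ?w = ?z")
    and b: "b \<noteq> 0" and c: "c \<noteq> 0"
  shows "surj \<phi>"
proof -
  obtain e g where e: "\<phi> weyl_p = normal_order e" and g: "\<phi> weyl_q = normal_order g"
    using normal_order_surj by metis
  have "ad ?z (normal_order e) = normal_order (smult [:b:] e)"
    unfolding e[symmetric] \<phi>[symmetric] weyl_hom_ad[OF hom, symmetric] ad_affine_pq_p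
    by (simp add: weyl_hom_simps[OF hom] e normal_order_scale)
  then have cf_e: "c * (of_nat i - of_nat j) * cf e i j = b * cf e i j" for i j
    using ad_affine_pq[of c d e] by (metis cf_smult normal_order_eq_iff)
  have "ad ?z (normal_order g) = normal_order (smult [:- b:] g)"
    unfolding g[symmetric] \<phi>[symmetric] weyl_hom_ad[OF hom, symmetric] ad_affine_pq_p
    by (simp only: weyl_hom_simps(7)[OF hom] g normal_order_scale)
  then have cf_g: "c * (of_nat i - of_nat j) * cf g i j = - b * cf g i j" for i j
    using ad_affine_pq[of c d g] by (metis cf_smult normal_order_eq_iff)
  have supp_e: "of_nat i - of_nat j = b / c" if "cf e i j \<noteq> 0" for i j
  proof -
    have "c * (of_nat i - of_nat j) = b" using cf_e[of i j] that by (metis mult_right_cancel)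
    then show ?thesis using c by (simp add: nonzero_eq_divide_eq mult.commute)
  qed
  have supp_g: "of_nat j - of_nat i = b / c" if "cf g i j \<noteq> 0" for i j
  proof -
    have "c * (of_nat i - of_nat j) = - b" using cf_g[of i j] that by (metis mult_right_cancel)
    then have "c * (of_nat j - of_nat i) = b" by (simp add: algebra_simps eq_neg_iff_add_eq_0)
    then show ?thesis using c by (simp add: nonzero_eq_divide_eq mult.commute)
  qed
  have "weyl_p \<noteq> (0 :: 'k weyl)" "weyl_q \<noteq> (0 :: 'k weyl)"
    using weyl_relation' by (metis add_0 mult_zero_left mult_zero_right one_neq_zero)+
  then have "e \<noteq> 0" "g \<noteq> 0"
    using e g by (metis normal_order_0 weyl_hom_eq_0_iff)+
  have "weyl_scale b (\<phi> weyl_p * \<phi> weyl_q) = ?z - weyl_scale a 1"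
    using \<phi> by (simp add: weyl_hom_simps[OF hom] algebra_simps)
  then have "normal_order e * normal_order g = weyl_scale (inverse b) (?z - weyl_scale a 1)"
    using b by (metis e g weyl_scale_cancel)
  also have "?z - weyl_scale a 1 = normal_order (bimonom c 1 1 + bimonom (d - a) 0 0)"
    by (simp add: normal_order_add normal_order_bimonom weyl.scale_left_diff_distrib)
  also have "weyl_scale (inverse b) \<dots> \<in> total.filt 2"
    by (intro total.filt_scale) (simp add: total.wle_add total.wle_bimonom)
  finally have prod: "normal_order e * normal_order g \<in> total.filt 2" .
  obtain m e0 e1 where e01: "e = e0 + e1" "e0 \<noteq> 0" "total.whom m e0" "total.wle (m - 1) e1"
    using total.exists_leading[OF \<open>e \<noteq> 0\<close>] by metis
  obtain n g0 g1 where g01: "g = g0 + g1" "g0 \<noteq> 0" "total.whom n g0" "total.wle (n - 1) g1"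
    using total.exists_leading[OF \<open>g \<noteq> 0\<close>] by metis
  have bc: "b / c \<noteq> 0" using b c by simp
  have "m \<ge> 1"
  proof -
    obtain i j where ij: "cf e0 i j \<noteq> 0" using e01(2) by (metis cf_0 cf_eqI)
    then have m: "1 * int i + 1 * int j = m" by (rule total.whomD[OF e01(3)])
    with ij have "cf e i j \<noteq> 0" using total.cf_whom_add_wle[OF e01(4)] e01(1) by simp
    with supp_e bc have "i \<noteq> j" by fastforce
    with m show ?thesis by linarith
  qed
  have "n \<ge> 1"
  proof -
    obtain i j where ij: "cf g0 i j \<noteq> 0" using g01(2) by (metis cf_0 cf_eqI)
    then have n: "1 * int i + 1 * int j = n" by (rule total.whomD[OF g01(3)])
    with ij have "cf g i j \<noteq> 0" using total.cf_whom_add_wle[OF g01(4)] g01(1) by simp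
    with supp_g bc have "i \<noteq> j" by fastforce
    with n show ?thesis by linarith
  qed
  have em: "total.wle m e" and gn: "total.wle n g"
    unfolding e01(1) g01(1) using total.whom_imp_wle[OF e01(3)] total.whom_imp_wle[OF g01(3)]
      total.wle_mono[OF e01(4)] total.wle_mono[OF g01(4)] by (auto intro: total.wle_add)
  have "m + n \<le> 2"
  proof (rule ccontr)
    assume "\<not> m + n \<le> 2"
    obtain r where r: "total.wle (m + n - 2 * (1 + 1)) r"
      "normal_order e * normal_order g = normal_order (e * g + dY e * dX g + r)"
      using total.normal_order_mult[OF em gn] by blast
    have "total.wle (m + n - 1) (e * g + dY e * dX g + r)"
      using prod \<open>\<not> m + n \<le> 2\<close> by (auto simp: r(2) intro: total.wle_mono)
    moreover have "total.wle (m + n - 1) (dY e * dX g)"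
      using total.wle_mult[OF total.wle_dY[OF em] total.wle_dX[OF gn]] by (rule total.wle_mono) simp
    moreover have "total.wle (m + n - 1) r" using r(1) by (rule total.wle_mono) simp
    moreover have "total.wle (m + n - 1) (e * g1)" using total.wle_mult[OF em g01(4)] by (simp add: algebra_simps)
    moreover have "total.wle (m + n - 1) (e1 * g0)"
      using total.wle_mult[OF e01(4) total.whom_imp_wle[OF g01(3)]] by (simp add: algebra_simps)
    \<comment> \<open>Subtracting all terms of lower degree isolates the product of the leading
      forms, which cannot vanish in a domain.\<close>
    ultimately have "total.wle (m + n - 1) (e * g + dY e * dX g + r - r - dY e * dX g - e * g1 - e1 * g0)"
      by (intro total.wle_diff)
    also have "e * g + dY e * dX g + r - r - dY e * dX g - e * g1 - e1 * g0 = e0 * g0"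
      by (simp add: e01(1) g01(1) algebra_simps)
    finally have "total.wle (m + n - 1) (e0 * g0)" .
    then have "e0 * g0 = 0"
      using total.whom_wle_eq_0[OF total.whom_mult[OF e01(3) g01(3)]] by simp
    with e01 g01 show False by simp
  qed
  with \<open>m \<ge> 1\<close> \<open>n \<ge> 1\<close> have "m = 1" "n = 1" by linarith+
  with em gn have e1: "total.wle 1 e" and g1: "total.wle 1 g" by simp_all
  have small_e: "(i = 1 \<and> j = 0 \<and> b / c = 1) \<or> (i = 0 \<and> j = 1 \<and> b / c = - 1)" if "cf e i j \<noteq> 0" for i j
  proof -
    have "i \<noteq> j" using supp_e[OF that] bc by force
    with total.wleD[OF e1 that] have "(i = 1 \<and> j = 0) \<or> (i = 0 \<and> j = 1)" by linarith
    with supp_e[OF that] show ?thesis by auto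
  qed
  have small_g: "(i = 0 \<and> j = 1 \<and> b / c = 1) \<or> (i = 1 \<and> j = 0 \<and> b / c = - 1)" if "cf g i j \<noteq> 0" for i j
  proof -
    have "i \<noteq> j" using supp_g[OF that] bc by force
    with total.wleD[OF g1 that] have "(i = 1 \<and> j = 0) \<or> (i = 0 \<and> j = 1)" by linarith
    with supp_g[OF that] show ?thesis by auto
  qed
  \<comment> \<open>This separates the two possible values of b/c, so that each image is a single
    monomial.\<close>
  have neg: "(1 :: 'k) \<noteq> - 1" by (metis add.right_inverse one_add_one zero_neq_numeral)
  obtain i j where "cf e i j \<noteq> 0" using \<open>e \<noteq> 0\<close> by (metis cf_0 cf_eqI)
  with small_e consider "b / c = 1" | "b / c = - 1" by blast
  then have "(weyl_p :: 'k weyl) \<in> range \<phi> \<and> (weyl_q :: 'k weyl) \<in> range \<phi>"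
  proof cases
    case 1
    have "e = bimonom (cf e 1 0) 1 0"
      by (rule cf_eqI) (use small_e 1 neg in \<open>force simp: cf_bimonom\<close>)
    moreover from this \<open>e \<noteq> 0\<close> have "cf e 1 0 \<noteq> 0" by auto
    ultimately have "\<phi> (weyl_scale (inverse (cf e 1 0)) weyl_p) = weyl_p"
      using normal_order_bimonom[of "cf e 1 0" 1 0] e by (simp add: weyl_hom_simps[OF hom])
    moreover have "g = bimonom (cf g 0 1) 0 1"
      by (rule cf_eqI) (use small_g 1 neg in \<open>force simp: cf_bimonom\<close>)
    moreover from this \<open>g \<noteq> 0\<close> have "cf g 0 1 \<noteq> 0" by auto
    ultimately have "\<phi> (weyl_scale (inverse (cf e 1 0)) weyl_p) = weyl_p"
      "\<phi> (weyl_scale (inverse (cf g 0 1)) weyl_q) = weyl_q"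
      using normal_order_bimonom[of "cf g 0 1" 0 1] g by (simp_all add: weyl_hom_simps[OF hom])
    then show ?thesis by (metis rangeI)
  next
    case 2
    have "e = bimonom (cf e 0 1) 0 1"
      by (rule cf_eqI) (use small_e 2 neg in \<open>force simp: cf_bimonom\<close>)
    moreover from this \<open>e \<noteq> 0\<close> have "cf e 0 1 \<noteq> 0" by auto
    ultimately have "\<phi> (weyl_scale (inverse (cf e 0 1)) weyl_p) = weyl_q"
      using normal_order_bimonom[of "cf e 0 1" 0 1] e by (simp add: weyl_hom_simps[OF hom])
    moreover have "g = bimonom (cf g 1 0) 1 0"
      by (rule cf_eqI) (use small_g 2 neg in \<open>force simp: cf_bimonom\<close>)
    moreover from this \<open>g \<noteq> 0\<close> have "cf g 1 0 \<noteq> 0" by auto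
    ultimately have "\<phi> (weyl_scale (inverse (cf e 0 1)) weyl_p) = weyl_q"
      "\<phi> (weyl_scale (inverse (cf g 1 0)) weyl_q) = weyl_p"
      using normal_order_bimonom[of "cf g 1 0" 1 0] g by (simp_all add: weyl_hom_simps[OF hom])
    then show ?thesis by (metis rangeI)
  qed
  then have ranges: "weyl_p \<in> range \<phi>" "weyl_q \<in> range \<phi>" by blast+
  show ?thesis by (rule weyl_hom_surjI[OF hom ranges])
qed

end

section \<open>Reduction of the general case to normal forms\<close>

lemma weyl_hom_surj_if_normal_forms:
  fixes \<phi> :: "'k::field_char_0 weyl \<Rightarrow> 'k weyl"
  assumes hom: "weyl_hom \<phi>" and w: "normal_form w" and z: "normal_form (\<phi> w)"
    and noncentral: "ad (\<phi> w) y \<noteq> 0"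
  shows "surj \<phi>"
  using z
proof (cases rule: normal_form_cases)
  case (1 u)
  then have u: "pderiv u \<noteq> 0" using noncentral normal_order_inY_central by metis
  from w show ?thesis
  proof (cases rule: normal_form_cases)
    case (1 v)
    then show ?thesis
      using surj_nilpotent_nilpotent[OF hom _ u, of v] \<open>\<phi> w = normal_order (inY u)\<close>
      by (simp add: normal_order_inY)
  next
    case (2 b a)
    then show ?thesis using not_semisimple_nilpotent[OF hom] 1 by metis
  qed
next
  case z: (2 c d)
  from w show ?thesis
  proof (cases rule: normal_form_cases)
    case (1 v)
    then show ?thesis using not_nilpotent_semisimple[OF hom] z by metis
  next
    case (2 b a)
    then show ?thesis using surj_semisimple_semisimple[OF hom] z by metis
  qed
qed

text \<open>Non-centrality comes from the strictness of the inclusions: C(z) is proper in N(z) = A_1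
  in one case, and in the other an eigenvector for a nonzero eigenvalue does not commute with
  z.\<close>

lemma strictly_nilpotent_or_semisimple:
  assumes "z \<in> \<Omega>\<^sub>1 \<union> \<Omega>\<^sub>2"
  shows "locally_finite z" and "\<exists>y. ad z y \<noteq> 0"
proof -
  have "locally_finite z \<and> (\<exists>y. ad z y \<noteq> 0)"
    using assms
  proof
    assume "z \<in> \<Omega>\<^sub>1"
    then have "weyl_N z = UNIV" "weyl_C z \<noteq> UNIV" by (auto simp: strictly_nilpotent_def)
    then show ?thesis using locally_finite_if_N by (auto simp: weyl_C_def)
  next
    assume "z \<in> \<Omega>\<^sub>2"
    then have z: "weyl_F z = UNIV" "{0} \<subset> weyl_Ev z" by (auto simp: strictly_semisimple_def)
    then obtain c where "c \<in> weyl_Ev z" "c \<noteq> 0" by blast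
    then obtain x where "x \<noteq> 0" "ad z x = weyl_scale c x" by (auto simp: weyl_Ev_def)
    with \<open>c \<noteq> 0\<close> have "ad z x \<noteq> 0" by simp
    with z(1) show ?thesis using locally_finite_if_F by blast
  qed
  then show "locally_finite z" "\<exists>y. ad z y \<noteq> 0" by blast+
qed

theorem corollary3p10:
  fixes \<phi> :: "'k::{alg_closed_field, field_char_0} weyl \<Rightarrow> 'k weyl"
  assumes "weyl_hom \<phi>"
    and "range \<phi> \<inter> (\<Omega>\<^sub>1 \<union> \<Omega>\<^sub>2) \<noteq> {}"
  shows "\<phi> \<in> weyl_Aut"
proof -
  obtain w where w: "\<phi> w \<in> \<Omega>\<^sub>1 \<union> \<Omega>\<^sub>2" using assms(2) by blast
  obtain y where y: "ad (\<phi> w) y \<noteq> 0" using strictly_nilpotent_or_semisimple[OF w] by blast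
  have fin: "locally_finite (\<phi> w)" using strictly_nilpotent_or_semisimple[OF w] by blast
  then have "locally_finite w" using locally_finite_hom_image assms(1) weyl_hom_inj by blast
  then obtain \<alpha> where \<alpha>: "\<alpha> \<in> weyl_Aut" "normal_form (\<alpha> w)"
    using locally_finite_normalizable by (auto simp: normalizable_def)
  obtain \<beta> where \<beta>: "\<beta> \<in> weyl_Aut" "normal_form (\<beta> (\<phi> w))"
    using fin locally_finite_normalizable by (auto simp: normalizable_def)
  have hom: "weyl_hom \<alpha>" "bij \<alpha>" "weyl_hom \<beta>" "bij \<beta>" using \<alpha> \<beta> by (auto simp: weyl_Aut_def)
  \<comment> \<open>This homomorphism carries the normal form \<open>\<alpha> w\<close> to the
    normal form \<open>\<beta> (\<phi> w)\<close>, and it is surjective exactly when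
    \<open>\<phi>\<close> is.\<close>
  define \<psi> where "\<psi> = \<beta> \<circ> \<phi> \<circ> inv \<alpha>"
  have \<psi>: "weyl_hom \<psi>"
    unfolding \<psi>_def using assms(1) hom by (intro weyl_hom_comp weyl_hom_inv)
  have \<psi>_\<alpha>: "\<psi> (\<alpha> x) = \<beta> (\<phi> x)" for x
    using hom(2) by (simp add: \<psi>_def bij_is_inj)
  have "\<beta> (ad (\<phi> w) y) \<noteq> 0"
    using y hom(3,4) by (simp add: weyl_hom_eq_0_iff)
  then have "ad (\<psi> (\<alpha> w)) (\<beta> y) \<noteq> 0" by (simp add: \<psi>_\<alpha> weyl_hom_ad[OF hom(3)])
  with weyl_hom_surj_if_normal_forms[OF \<psi> \<alpha>(2)] \<beta>(2) have "surj \<psi>" by (simp add: \<psi>_\<alpha>)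
  have "\<exists>x. y = \<phi> x" for y
  proof -
    obtain x where "\<beta> y = \<psi> x" using \<open>surj \<psi>\<close> by (metis surjD)
    also have "\<dots> = \<beta> (\<phi> (inv \<alpha> x))" by (simp add: \<psi>_def)
    finally have "y = \<phi> (inv \<alpha> x)" using hom(4) by (metis bij_is_inj injD)
    then show ?thesis by blast
  qed
  then have "surj \<phi>" by (simp add: surj_def)
  with assms(1) weyl_hom_inj[OF assms(1)] show ?thesis
    by (simp add: weyl_Aut_def bij_def)
qed

end
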